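(* Let $n\ge 1$, let $P\in\mathscr{P}_n$ be a polynomial which does not vanish in $|z|<1$, and let $B\in\mathcal{B}_n$ have parameters $\lambda_0,\lambda_1,\lambda_2$. Then for every $0\le p<\infty$ and every $R>1$, with $\sigma(z)=Rz$, $$\left\|B[P\circ\sigma](z)\right\|_p\le\frac{\left\|R^n\Lambda_n z+\lambda_0\right\|_p}{\|1+z\|_p}\,\|P(z)\|_p .$$ The result is sharp: equality holds for $P(z)=az^n+b$ with $|a|=|b|=1$.
   Context: $\mathscr{P}_n$ is the space of complex polynomials of degree at most $n$. For a polynomial $Q$, define $\|Q(z)\|_0:=\exp\left\{\frac1{2\pi}\int_0^{2\pi}\log|Q(e^{i\theta})|\,d\theta\right\}$ and, for $0<p<\infty$, $\|Q(z)\|_p:=\left\{\frac1{2\pi}\int_0^{2\pi}|Q(e^{i\theta})|^p\,d\theta\right\}^{1/p}$. $P\circ\sigma$ denotes the composite $(P\circ\sigma)(z)=P(\sigma(z))$. The class $\mathcal{B}_n$ consists of the operators $B$ carrying $P\in\mathscr{P}_n$ into $$B[P](z):=\lambda_0P(z)+\lambda_1\left(\frac{nz}{2}\right)\frac{P'(z)}{1!}+\lambda_2\left(\frac{nz}{2}\right)^2\frac{P''(z)}{2!},$$ where $\lambda_0,\lambda_1,\lambda_2\in\mathbb{C}$ are such that all the zeros of $U(z):=\lambda_0+\lambda_1\binom n1 z+\lambda_2\binom n2 z^2$ lie in the half plane $|z|\le|z-n/2|$. Also $\Lambda_n:=\lambda_0+\lambda_1\frac{n^2}{2}+\lambda_2\frac{n^3(n-1)}{8}$.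 *)

theory Defs
  imports "HOL-Analysis.Analysis" "HOL-Computational_Algebra.Polynomial"
begin

(* Meant for p >= 0.  For p = 0 the zero polynomial is treated separately: there the
   logarithm is identically -\<infinity> and the value is exp (-\<infinity>) = 0, whereas HOL's
   convention ln 0 = 0 would give 1.  For Q \<noteq> 0 the function ln |Q(e^{i \<theta>})| is
   Lebesgue integrable, and its value at the finitely many zeros is immaterial. *)
definition circle_norm :: "real \<Rightarrow> complex poly \<Rightarrow> real" where
  "circle_norm p Q =
     (if p = 0 then
        (if Q = 0 then 0
         else exp (1 / (2 * pi) * (LBINT \<theta>:{0..2 * pi}. ln (cmod (poly Q (cis \<theta>))))))
      else (1 / (2 * pi) * (LBINT \<theta>:{0..2 * pi}. cmod (poly Q (cis \<theta>)) powr p)) powr (1 / p))"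

definition B_op ::
  "nat \<Rightarrow> complex \<Rightarrow> complex \<Rightarrow> complex \<Rightarrow> complex poly \<Rightarrow> complex poly" where
  "B_op n l0 l1 l2 P =
     smult l0 P
     + smult l1 ([:0, of_nat n / 2:] * smult (1 / fact 1) (pderiv P))
     + smult l2 ([:0, of_nat n / 2:] ^ 2 * smult (1 / fact 2) (pderiv (pderiv P)))"

definition U_poly :: "nat \<Rightarrow> complex \<Rightarrow> complex \<Rightarrow> complex \<Rightarrow> complex poly" where
  "U_poly n l0 l1 l2 = [:l0, l1 * of_nat (n choose 1), l2 * of_nat (n choose 2):]"

definition B_class_params :: "nat \<Rightarrow> complex \<Rightarrow> complex \<Rightarrow> complex \<Rightarrow> bool" where
  "B_class_params n l0 l1 l2 \<longleftrightarrow>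
     (\<forall>z. poly (U_poly n l0 l1 l2) z = 0 \<longrightarrow> cmod z \<le> cmod (z - of_nat n / 2))"

definition Lambda :: "nat \<Rightarrow> complex \<Rightarrow> complex \<Rightarrow> complex \<Rightarrow> complex" where
  "Lambda n l0 l1 l2 =
     l0 + l1 * (of_nat n ^ 2 / 2) + l2 * (of_nat n ^ 3 * (of_nat n - 1) / 8)"

end

theory Submission
  imports Defs "HOL-Complex_Analysis.Complex_Analysis" "HOL-Probability.Probability_Measure"
    "HOL-Computational_Algebra.Fundamental_Theorem_Algebra"
begin

text \<open>
  On the monomials \<open>z^k\<close> with \<open>k \<le> n\<close> the operator \<open>B\<close> acts by multiplication with scalars \<open>\<mu>\<^sub>k\<close>,
  where \<open>\<mu>\<^sub>0 = \<lambda>\<^sub>0\<close> and \<open>\<mu>\<^sub>n = \<Lambda>\<close>. Write \<open>T P = B[P \<circ> \<sigma>]\<close> and let \<open>P*\<close> denote the conjugate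
  reversal \<open>z^n cnj (P (1 / cnj z))\<close>, which has the same modulus as \<open>P\<close> on the unit circle.

  The hypothesis on the zeros of \<open>U\<close> enters through Laguerre's theorem on polar derivatives
  (\<open>laguerre\<close>). If \<open>z\<close> lies outside the closed unit disc, then \<open>B[F](z)\<close> is, up to a nonzero factor,
  an iterated polar derivative of \<open>F\<close> at \<open>z\<close>; the poles are \<open>z - n z / (2 w)\<close> for the zeros \<open>w\<close> of
  \<open>U\<close>, and the half-plane condition says exactly that they are at least as far from the origin as
  \<open>z\<close>. Hence \<open>B\<close> maps the set of polynomials of degree \<open>n\<close> with all zeros in the closed unit disc
  into itself (\<open>B_op_disc_polys\<close>). For any linear map with this property, \<open>\<bar>G\<bar> \<le> \<bar>F\<bar>\<close> outside
  the disc implies \<open>\<bar>L G\<bar> \<le> \<bar>L F\<bar>\<close> there, provided \<open>F\<close> is in that set (\<open>norm_L_le\<close>): otherwise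
  some \<open>G - w F\<close> with \<open>\<bar>w\<bar> > 1\<close> would be sent to a polynomial with a zero outside.
  Two consequences follow. If \<open>P\<close> does not vanish in the open disc, then
  \<open>\<bar>T P\<bar> \<le> \<bar>T P*\<bar>\<close> on the circle. And for every \<open>\<bar>w\<bar> = 1\<close> the symmetrised operator
  \<open>P \<mapsto> T P + w (T P*)*\<close> again preserves the class of polynomials with zeros in the closed disc;
  it multiplies \<open>z^n\<close> by \<open>R^n \<Lambda> + w cnj \<lambda>\<^sub>0\<close>.

  Arestov's inequality (\<open>arestov\<close>) states that a coefficient multiplier preserving that class has
  \<open>L\<^sup>p\<close> bound \<open>\<bar>g\<^sub>n\<bar>\<close>, where \<open>g\<^sub>n\<close> is its factor at \<open>z^n\<close>. For the geometric mean this follows from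
  the comparison principle and Jensen's formula after reflecting the outer zeros of \<open>P\<close> into the disc.
  Applying it to \<open>P + w z^n\<close> and averaging over \<open>w\<close> replaces \<open>ln\<close> by its positive part, because
  the mean of \<open>ln \<bar>u + w\<bar>\<close> is the positive part of \<open>ln \<bar>u\<bar>\<close>; and \<open>u^p\<close> is a mixture of
  positive parts of \<open>ln (u s)\<close> over \<open>s > 0\<close>.

  For \<open>p > 0\<close> apply Arestov's inequality to the symmetrised operators and average over \<open>w\<close>. On the
  right this gives the norm of \<open>R^n \<Lambda> z + \<lambda>\<^sub>0\<close>. On the left, \<open>\<bar>T P\<bar> \<le> \<bar>(T P*)*\<bar>\<close> pointwise on the
  circle, so the mean of \<open>\<bar>T P + w (T P*)*\<bar>^p\<close> over \<open>w\<close> is at least \<open>\<bar>T P\<bar>^p\<close> times the mean of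
  \<open>\<bar>1 + w\<bar>^p\<close>. For \<open>p = 0\<close> the geometric-mean inequality for \<open>T\<close> itself suffices.
  Equality for \<open>a z^n + b\<close> holds because arc length is invariant under \<open>z \<mapsto> z^n\<close> and under rotations
  if \<open>p > 0\<close>, and because the geometric means are moduli of leading coefficients if \<open>p = 0\<close>.
\<close>

section \<open>Polynomials with all zeros in the closed unit disc\<close>

definition disc_polys :: "nat \<Rightarrow> complex poly set" where
  "disc_polys n = {F. degree F = n \<and> (\<forall>z. poly F z = 0 \<longrightarrow> cmod z \<le> 1)}"

lemma disc_polysD:
  assumes "F \<in> disc_polys n"
  shows "degree F = n" "F \<noteq> 0" "coeff F n \<noteq> 0" "\<And>z. poly F z = 0 \<Longrightarrow> cmod z \<le> 1"
proof -
  show d: "degree F = n" and z: "\<And>z. poly F z = 0 \<Longrightarrow> cmod z \<le> 1"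
    using assms by (auto simp: disc_polys_def)
  show "F \<noteq> 0"
    using z[of 2] by auto
  then show "coeff F n \<noteq> 0"
    using d by auto
qed

lemma disc_polysI:
  assumes "degree F \<le> n" "coeff F n \<noteq> 0" "\<And>z. cmod z > 1 \<Longrightarrow> poly F z \<noteq> 0"
  shows "F \<in> disc_polys n"
  using assms by (force simp: disc_polys_def not_le[symmetric] intro: le_antisym le_degree)

lemma disc_polys_factor:
  assumes "F \<in> disc_polys n"
  obtains A where "size A = n" "\<And>u. u \<in># A \<Longrightarrow> cmod u \<le> 1"
    "F = smult (coeff F n) (\<Prod>u\<in>#A. [:-u, 1:])"
proof -
  obtain A where A: "size A = degree F" "F = smult (lead_coeff F) (\<Prod>u\<in>#A. [:-u, 1:])"
    using alg_closed_imp_factorization disc_polysD(2)[OF assms] by blast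
  have "poly F u = 0" if "u \<in># A" for u
    using that by (subst A(2)) (auto simp: poly_prod_mset)
  then show ?thesis
    using that A disc_polysD[OF assms] by metis
qed

lemma poly_pderiv_prod_roots:
  fixes z :: complex
  assumes "\<And>u. u \<in># A \<Longrightarrow> z \<noteq> u"
  shows "poly (pderiv (\<Prod>u\<in>#A. [:-u, 1:])) z =
    poly (\<Prod>u\<in>#A. [:-u, 1:]) z * (\<Sum>u\<in>#A. 1 / (z - u))"
  using assms
proof (induction A)
  case (add u A)
  define Q where "Q = (\<Prod>u\<in>#A. [:-u, 1:])"
  have zu: "z \<noteq> u"
    using add.prems by auto
  have "poly (pderiv Q) z = poly Q z * (\<Sum>u\<in>#A. 1 / (z - u))"
    unfolding Q_def using add by auto
  moreover have "poly (pderiv ([:-u, 1:] * Q)) z = poly Q z + (z - u) * poly (pderiv Q) z"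
    by (subst pderiv_mult) (simp add: pderiv_pCons algebra_simps)
  moreover have "poly ([:-u, 1:] * Q) z = (z - u) * poly Q z"
    by (simp add: algebra_simps)
  moreover have "(\<Prod>u\<in>#add_mset u A. [:-u, 1:]) = [:-u, 1:] * Q"
    by (simp only: Q_def image_mset_add_mset prod_mset.add_mset)
  ultimately show ?case
    using zu by (simp only: image_mset_add_mset sum_mset.add_mset) (simp add: field_simps del: mult_pCons_left)
qed auto

lemma reflected_factor_le:
  fixes u z :: complex
  assumes "cmod u \<le> 1" "cmod z \<ge> 1"
  shows "cmod (1 - cnj u * z) \<le> cmod (z - u)"
proof -
  have "(cmod (z - u))\<^sup>2 - (cmod (1 - cnj u * z))\<^sup>2 = (1 - (cmod u)\<^sup>2) * ((cmod z)\<^sup>2 - 1)"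
    unfolding cmod_power2 by (simp add: algebra_simps power2_eq_square)
  moreover have "\<dots> \<ge> 0"
    using assms by (intro mult_nonneg_nonneg) (auto simp: abs_square_le_1)
  ultimately have "(cmod (1 - cnj u * z))\<^sup>2 \<le> (cmod (z - u))\<^sup>2"
    by linarith
  then show ?thesis
    by (rule power2_le_imp_le) simp
qed

text \<open>
  As \<open>u\<close> runs over the closed unit disc, the quantity \<open>a + (b - a z) / (z - u) = (b - a u) / (z - u)\<close>
  is a Moebius image of the disc, hence lies in a disc. That disc is centred at a positive multiple of
  \<open>b cnj z - a\<close> and misses the origin because \<open>\<bar>a\<bar> < \<bar>b\<bar>\<close>, so all values lie in one open half plane
  through the origin; this makes sums of such terms nonzero.
\<close>
lemma half_plane_term:
  fixes a b u z :: complex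
  assumes "cmod u \<le> 1" "cmod z > 1" "cmod a < cmod b"
  shows "Re (cnj (b * cnj z - a) * (a + (b - a * z) / (z - u))) > 0"
proof -
  define c where "c = b * cnj z - a"
  define d where "d = (b - a * z) * ((cnj z * u - 1) / (z - u))"
  have zu: "z \<noteq> u"
    using assms by auto
  have z2: "(cmod z)\<^sup>2 - 1 > 0"
    using assms by simp
  \<comment> \<open>Up to the positive factor \<open>\<bar>z\<bar>\<^sup>2 - 1\<close> the term is the centre \<open>c\<close> plus a deviation \<open>d\<close> with \<open>\<bar>d\<bar> < \<bar>c\<bar>\<close>.\<close>
  have id: "(a + (b - a * z) / (z - u)) * of_real ((cmod z)\<^sup>2 - 1) = c + d"
    using zu unfolding c_def d_def of_real_diff complex_norm_square of_real_1
    by (simp add: field_simps)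
  have cd: "cmod (b - a * z) < cmod c"
  proof -
    have "(cmod c)\<^sup>2 - (cmod (b - a * z))\<^sup>2 = ((cmod b)\<^sup>2 - (cmod a)\<^sup>2) * ((cmod z)\<^sup>2 - 1)"
      unfolding cmod_power2 c_def by (simp add: algebra_simps power2_eq_square)
    moreover have "\<dots> > 0"
      using assms z2 by (intro mult_pos_pos) (auto intro: power_strict_mono)
    ultimately have "(cmod (b - a * z))\<^sup>2 < (cmod c)\<^sup>2"
      by linarith
    then show ?thesis
      by (rule power2_less_imp_less) simp
  qed
  have "cmod (cnj z * u - 1) \<le> cmod (z - u)"
    using reflected_factor_le[of u z] assms
    by (metis (no_types) complex_cnj_cnj complex_cnj_diff complex_cnj_mult complex_cnj_one
        complex_mod_cnj less_imp_le mult.commute norm_minus_commute)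
  then have "cmod d \<le> cmod (b - a * z)"
    using zu unfolding d_def norm_mult norm_divide
    by (intro mult_right_le_one_le) (auto simp: divide_le_eq)
  then have d: "cmod d < cmod c"
    using cd by simp
  have "Re (cnj c * d) \<ge> - (cmod c * cmod d)"
    using abs_Re_le_cmod[of "cnj c * d"] by (simp add: norm_mult)
  moreover have "Re (cnj c * c) = cmod c * cmod c"
    by (metis cmod_power2 complex_norm_square mult.commute of_real_power power2_eq_square Re_complex_of_real)
  moreover have "cmod c * cmod d < cmod c * cmod c"
    using d by (intro mult_strict_left_mono) (auto intro: le_less_trans[OF norm_ge_zero])
  ultimately have "Re (cnj c * (c + d)) > 0"
    by (simp add: distrib_left)
  then have "Re (cnj c * (a + (b - a * z) / (z - u))) * ((cmod z)\<^sup>2 - 1) > 0"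
    unfolding id[symmetric] by (simp only: mult.assoc[symmetric] Re_complex_of_real times_complex.sel Im_complex_of_real mult_zero_right diff_zero)
  then show ?thesis
    using z2 unfolding c_def by (simp add: zero_less_mult_iff)
qed

lemma Re_sum_mset_pos:
  fixes f :: "'a \<Rightarrow> complex"
  assumes "A \<noteq> {#}" "\<And>u. u \<in># A \<Longrightarrow> Re (c * f u) > 0"
  shows "Re (c * (\<Sum>u\<in>#A. f u)) > 0"
  using assms
proof (induction A)
  case (add u A)
  then show ?case
    by (cases "A = {#}") (auto simp: distrib_left intro!: add_pos_pos)
qed auto

lemma sum_mset_roots_le:
  fixes A :: "complex multiset"
  assumes "\<And>u. u \<in># A \<Longrightarrow> cmod u \<le> 1"
  shows "cmod (\<Sum>u\<in>#A. u) \<le> size A"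
  using assms
proof (induction A)
  case (add u A)
  then have "cmod u \<le> 1" "cmod (\<Sum>u\<in>#A. u) \<le> size A"
    by auto
  then have "cmod (u + (\<Sum>u\<in>#A. u)) \<le> 1 + real (size A)"
    by (rule norm_triangle_mono)
  then show ?case by simp
qed auto

lemma coeff_prod_roots:
  fixes A :: "complex multiset"
  shows "degree (\<Prod>u\<in>#A. [:-u, 1:]) = size A"
    and "coeff (\<Prod>u\<in>#A. [:-u, 1:]) (size A) = 1"
    and "A \<noteq> {#} \<Longrightarrow> coeff (\<Prod>u\<in>#A. [:-u, 1:]) (size A - 1) = - (\<Sum>u\<in>#A. u)"
proof (induction A)
  case (add u A)
  define Q where "Q = (\<Prod>u\<in>#A. [:-u, 1:])"
  have "Q \<noteq> 0"
    using add(2) unfolding Q_def by auto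
  case 1
  show ?case
  proof -
    have "degree ([:-u, 1:] * Q) = 1 + degree Q"
      using \<open>Q \<noteq> 0\<close> by (subst degree_mult_eq) auto
    then show ?thesis
      using add(1) by (simp add: Q_def del: mult_pCons_left)
  qed
  case 2
  show ?case
    using add(1,2) by (simp add: coeff_eq_0 flip: Q_def)
  case 3
  show ?case
    using add(2,3) by (cases "A = {#}"; cases "size A") (auto simp: Q_def)
qed auto

text \<open>
  Laguerre's theorem for the polar derivative \<open>m' F + (\<zeta> - z) F'\<close> with pole \<open>\<zeta> = b / a\<close> outside the
  disc and \<open>m' = m + 1\<close>. The pair \<open>(a, b)\<close> is used in place of \<open>\<zeta>\<close> so that \<open>a = 0\<close>, the pole at infinity, gives the
  ordinary derivative and thus the Gauss-Lucas theorem. At a point \<open>z\<close> outside the disc the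
  logarithmic derivative turns the polar derivative into \<open>F(z)\<close> times a sum of terms that lie in
  one open half plane.
\<close>
lemma laguerre:
  fixes a b :: complex
  assumes F: "F \<in> disc_polys (Suc m)" and ab: "cmod a < cmod b"
  shows "smult (a * of_nat (Suc m)) F + [:b, -a:] * pderiv F \<in> disc_polys m" (is "?E \<in> _")
proof -
  obtain A where A: "size A = Suc m" "\<And>u. u \<in># A \<Longrightarrow> cmod u \<le> 1"
    "F = smult (coeff F (Suc m)) (\<Prod>u\<in>#A. [:-u, 1:])"
    using disc_polys_factor[OF F] by metis
  define c where "c = coeff F (Suc m)"
  have c0: "c \<noteq> 0"
    using disc_polysD(3)[OF F] c_def by simp
  have dF: "degree F = Suc m"
    using disc_polysD[OF F] by simp
  have A0: "A \<noteq> {#}"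
    using A(1) by auto
  show ?thesis
  proof (rule disc_polysI)
    \<comment> \<open>The factor \<open>m + 1 - k\<close> removes the coefficient at \<open>k = m + 1\<close>.\<close>
    have high: "coeff ?E k = a * (of_nat (Suc m) - of_nat k) * coeff F k
       + b * of_nat (Suc k) * coeff F (Suc k)" for k
      by (cases k) (simp_all add: coeff_pderiv algebra_simps)
    show "degree ?E \<le> m"
    proof (rule degree_le, intro allI impI)
      fix k assume "k > m"
      then show "coeff ?E k = 0"
        unfolding high using dF by (cases "k = Suc m") (auto simp: coeff_eq_0)
    qed
    have "coeff F m = - c * (\<Sum>u\<in>#A. u)"
      using coeff_prod_roots(3)[OF A0] A(1) c_def by (subst A(3)) simp
    then have "coeff ?E m = c * (b * of_nat (Suc m) - a * (\<Sum>u\<in>#A. u))"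
      unfolding high by (simp add: c_def algebra_simps)
    moreover have "cmod (a * (\<Sum>u\<in>#A. u)) < cmod (b * of_nat (Suc m))"
    proof -
      have "cmod (\<Sum>u\<in>#A. u) \<le> real (Suc m)"
        using sum_mset_roots_le[of A] A by simp
      then have "cmod (a * (\<Sum>u\<in>#A. u)) \<le> cmod a * real (Suc m)"
        by (simp only: norm_mult mult_left_mono norm_ge_zero)
      also have "\<dots> < cmod b * real (Suc m)"
        using ab by simp
      finally show ?thesis
        by (simp only: norm_mult norm_of_nat)
    qed
    ultimately show "coeff ?E m \<noteq> 0"
      using c0 by auto
  next
    fix z assume z: "cmod z > 1"
    have zu: "z \<noteq> u" if "u \<in># A" for u
      using A(2)[OF that] z by auto
    have Fz: "poly F z \<noteq> 0"
      using disc_polysD(4)[OF F] z by force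
    have "poly (pderiv F) z = poly F z * (\<Sum>u\<in>#A. 1 / (z - u))"
      using poly_pderiv_prod_roots[of A z] zu
      by (subst (1 2) A(3)) (simp add: pderiv_smult)
    then have "poly ?E z = poly F z * (a * of_nat (size A) + (b - a * z) * (\<Sum>u\<in>#A. 1 / (z - u)))"
      by (simp add: A(1) algebra_simps)
    also have "a * of_nat (size A) + (b - a * z) * (\<Sum>u\<in>#A. 1 / (z - u))
        = (\<Sum>u\<in>#A. a + (b - a * z) / (z - u))"
      by (simp add: sum_mset.distrib sum_mset_distrib_left)
    finally have "poly ?E z = poly F z * (\<Sum>u\<in>#A. a + (b - a * z) / (z - u))" .
    moreover have "Re (cnj (b * cnj z - a) * (\<Sum>u\<in>#A. a + (b - a * z) / (z - u))) > 0"
      by (intro Re_sum_mset_pos A0 half_plane_term A z ab)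
    ultimately show "poly ?E z \<noteq> 0"
      using Fz by auto
  qed
qed

lemma disc_polys_mult:
  assumes "F \<in> disc_polys m" "G \<in> disc_polys k"
  shows "F * G \<in> disc_polys (m + k)" "coeff (F * G) (m + k) = coeff F m * coeff G k"
proof -
  show "F * G \<in> disc_polys (m + k)"
    using disc_polysD[OF assms(1)] disc_polysD[OF assms(2)]
    by (auto simp: disc_polys_def degree_mult_eq)
  show "coeff (F * G) (m + k) = coeff F m * coeff G k"
    using coeff_mult_degree_sum[of F G] disc_polysD(1)[OF assms(1)] disc_polysD(1)[OF assms(2)] by simp
qed

lemma monom_disc_polys: "c \<noteq> 0 \<Longrightarrow> monom c n \<in> disc_polys n"
  by (rule disc_polysI) (auto simp: degree_monom_eq poly_monom)

text \<open>
  Replacing each root \<open>u\<close> with \<open>\<bar>u\<bar> > 1\<close> by its mirror image \<open>1 / cnj u\<close>, that is, each factor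
  \<open>z - u\<close> by \<open>1 - cnj u z\<close>, does not change the modulus on the circle and does not decrease it
  outside. A degree below \<open>n\<close> counts as roots at infinity, which are reflected to the origin.
\<close>
lemma reflect_outer_roots:
  assumes P: "degree P \<le> n" "P \<noteq> 0"
  obtains F where "F \<in> disc_polys n" "\<And>z. cmod z = 1 \<Longrightarrow> cmod (poly F z) = cmod (poly P z)"
    "\<And>z. cmod z \<ge> 1 \<Longrightarrow> cmod (poly P z) \<le> cmod (poly F z)" "cmod (coeff P n) \<le> cmod (coeff F n)"
proof -
  obtain A where A: "size A = degree P" "P = smult (lead_coeff P) (\<Prod>u\<in>#A. [:-u, 1:])"
    using alg_closed_imp_factorization[OF P(2)] by metis
  have "\<exists>S\<in>disc_polys (size A). (\<forall>z. cmod z = 1 \<longrightarrow> cmod (poly S z) = cmod (poly (\<Prod>u\<in>#A. [:-u, 1:]) z))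
     \<and> (\<forall>z. cmod z \<ge> 1 \<longrightarrow> cmod (poly (\<Prod>u\<in>#A. [:-u, 1:]) z) \<le> cmod (poly S z)) \<and> 1 \<le> cmod (coeff S (size A))"
  proof (induction A)
    case empty
    show ?case
      by (rule bexI[of _ 1]) (auto simp: disc_polys_def)
  next
    case (add u A)
    then obtain S where S: "S \<in> disc_polys (size A)"
      "\<And>z. cmod z = 1 \<Longrightarrow> cmod (poly S z) = cmod (poly (\<Prod>u\<in>#A. [:-u, 1:]) z)"
      "\<And>z. cmod z \<ge> 1 \<Longrightarrow> cmod (poly (\<Prod>u\<in>#A. [:-u, 1:]) z) \<le> cmod (poly S z)"
      "1 \<le> cmod (coeff S (size A))"
      by blast
    have "\<exists>q\<in>disc_polys 1. (\<forall>z. cmod z = 1 \<longrightarrow> cmod (poly q z) = cmod (z - u))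
        \<and> (\<forall>z. cmod z \<ge> 1 \<longrightarrow> cmod (z - u) \<le> cmod (poly q z)) \<and> 1 \<le> cmod (coeff q 1)"
    proof (cases "cmod u \<le> 1")
      case True
      have "[:-u, 1:] \<in> disc_polys 1"
        using True by (auto simp: disc_polys_def)
      then show ?thesis
        by (rule bexI[rotated]) (auto simp: norm_minus_commute)
    next
      case False
      have u0: "u \<noteq> 0"
        using False by auto
      have eq: "poly [:1, - cnj u:] z = - cnj u * (z - 1 / cnj u)" for z
        using u0 by (simp add: field_simps)
      have "[:1, - cnj u:] \<in> disc_polys 1"
      proof (rule disc_polysI)
        fix z assume "cmod z > 1"
        then have "cmod (cnj u * z) > 1"
          using False by (simp add: norm_mult less_1_mult)
        then show "poly [:1, - cnj u:] z \<noteq> 0"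
          by (auto simp: algebra_simps)
      qed (use u0 in auto)
      moreover have "cmod (z - u) \<le> cmod (1 - cnj u * z)" if "cmod z \<ge> 1" for z
      proof -
        have "cmod (1 - cnj (1 / cnj u) * z) \<le> cmod (z - 1 / cnj u)"
          using that False by (intro reflected_factor_le) (auto simp: norm_divide divide_le_eq)
        then have "cmod u * cmod (1 - z / u) \<le> cmod u * cmod (z - 1 / cnj u)"
          by (intro mult_left_mono) auto
        also have "cmod u * cmod (1 - z / u) = cmod (z - u)"
          using u0 by (metis complex_cnj_cancel_iff diff_divide_distrib divide_self mult.commute nonzero_mult_div_cancel_left norm_minus_commute norm_mult times_divide_eq_right)
        also have "cmod u * cmod (z - 1 / cnj u) = cmod (1 - cnj u * z)"
        proof -
          have "1 - cnj u * z = - cnj u * (z - 1 / cnj u)"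
            using u0 by (simp add: field_simps)
          then show ?thesis
            by (simp only: norm_mult norm_minus_cancel complex_mod_cnj)
        qed
        finally show ?thesis .
      qed
      moreover have "cmod (1 - cnj u * z) = cmod (z - u)" if "cmod z = 1" for z
      proof -
        have "z - u = z * cnj (1 - cnj u * z)"
          using that complex_norm_square[of z] by (simp add: algebra_simps)
        then show ?thesis
          using that by (metis complex_mod_cnj mult_1 norm_mult)
      qed
      ultimately show ?thesis
        using False by (intro bexI[of _ "[:1, - cnj u:]"]) (auto simp: mult.commute)
    qed
    then obtain q where q: "q \<in> disc_polys 1" "\<And>z. cmod z = 1 \<Longrightarrow> cmod (poly q z) = cmod (z - u)"
      "\<And>z. cmod z \<ge> 1 \<Longrightarrow> cmod (z - u) \<le> cmod (poly q z)" "1 \<le> cmod (coeff q 1)"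
      by blast
    have Q: "poly (\<Prod>u\<in>#add_mset u A. [:-u, 1:]) x = (x - u) * poly (\<Prod>u\<in>#A. [:-u, 1:]) x" for x
      by (simp add: algebra_simps)
    show ?case
    proof (intro bexI[of _ "q * S"] conjI allI impI)
      show "q * S \<in> disc_polys (size (add_mset u A))"
        using disc_polys_mult(1)[OF q(1) S(1)] by simp
      have "1 * 1 \<le> cmod (coeff q 1) * cmod (coeff S (size A))"
        using q(4) S(4) by (intro mult_mono) auto
      then show "1 \<le> cmod (coeff (q * S) (size (add_mset u A)))"
        using disc_polys_mult(2)[OF q(1) S(1)] by (simp add: norm_mult)
    next
      fix z assume z: "cmod z = 1"
      show "cmod (poly (q * S) z) = cmod (poly (\<Prod>u\<in>#add_mset u A. [:-u, 1:]) z)"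
        unfolding Q poly_mult norm_mult using z by (simp add: q S)
    next
      fix z assume z: "cmod z \<ge> 1"
      show "cmod (poly (\<Prod>u\<in>#add_mset u A. [:-u, 1:]) z) \<le> cmod (poly (q * S) z)"
        unfolding Q poly_mult norm_mult using z by (intro mult_mono q S) auto
    qed
  qed
  then obtain S where S: "S \<in> disc_polys (degree P)"
      "\<And>z. cmod z = 1 \<Longrightarrow> cmod (poly S z) = cmod (poly (\<Prod>u\<in>#A. [:-u, 1:]) z)"
      "\<And>z. cmod z \<ge> 1 \<Longrightarrow> cmod (poly (\<Prod>u\<in>#A. [:-u, 1:]) z) \<le> cmod (poly S z)"
      "1 \<le> cmod (coeff S (degree P))"
    unfolding A(1) by blast
  define c where "c = lead_coeff P"
  have c: "c \<noteq> 0"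
    using P(2) by (simp add: c_def)
  have Pz: "poly P x = c * poly (\<Prod>u\<in>#A. [:-u, 1:]) x" for x
    unfolding c_def by (subst A(2)) simp
  define F where "F = monom c (n - degree P) * S"
  have nd: "n - degree P + degree P = n"
    using P(1) by simp
  have F: "F \<in> disc_polys n" "coeff F n = c * coeff S (degree P)"
    using disc_polys_mult[OF monom_disc_polys[OF c, of "n - degree P"] S(1)] unfolding F_def nd by simp_all
  show ?thesis
  proof (rule that[OF F(1)])
    show "cmod (poly F z) = cmod (poly P z)" if "cmod z = 1" for z
      using that S(2) by (simp add: F_def Pz poly_monom norm_mult norm_power)
    show "cmod (poly P z) \<le> cmod (poly F z)" if z: "cmod z \<ge> 1" for z
    proof -
      have "cmod c * cmod (poly (\<Prod>u\<in>#A. [:-u, 1:]) z) \<le> (cmod c * cmod z ^ (n - degree P)) * cmod (poly S z)"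
        using z S(3)[OF z] by (intro mult_mono) (auto simp: mult_le_cancel_left1)
      then show ?thesis
        by (simp add: F_def Pz poly_monom norm_mult norm_power)
    qed
    show "cmod (coeff P n) \<le> cmod (coeff F n)"
    proof (cases "degree P = n")
      case True
      then show ?thesis
        using S(4) unfolding F(2) norm_mult by (auto simp: c_def mult_le_cancel_left1)
    next
      case False
      then show ?thesis
        using P(1) by (simp add: coeff_eq_0)
    qed
  qed
qed

section \<open>The operator B and its multipliers\<close>

definition B_mult :: "nat \<Rightarrow> complex \<Rightarrow> complex \<Rightarrow> complex \<Rightarrow> nat \<Rightarrow> complex" where
  "B_mult n l0 l1 l2 k = l0 + l1 * of_nat n * of_nat k / 2
     + l2 * of_nat n ^ 2 * of_nat k * (of_nat k - 1) / 8"

lemma coeff_B_op: "coeff (B_op n l0 l1 l2 P) k = B_mult n l0 l1 l2 k * coeff P k"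
proof -
  define c :: complex where "c = of_nat n / 2"
  have n: "of_nat n = 2 * c"
    by (simp add: c_def)
  have *: "B_op n l0 l1 l2 P = smult l0 P + pCons 0 (smult (l1 * c) (pderiv P))
      + pCons 0 (pCons 0 (smult (l2 * c^2 / 2) (pderiv (pderiv P))))"
    by (simp add: B_op_def c_def[symmetric] power2_eq_square fact_numeral)
  consider "k = 0" | "k = 1" | m where "k = Suc (Suc m)"
    by (metis One_nat_def not0_implies_Suc)
  then show ?thesis
    unfolding B_mult_def n *
    by cases (simp_all add: coeff_pderiv power2_eq_square field_simps)
qed

lemma B_mult_0: "B_mult n l0 l1 l2 0 = l0"
  by (simp add: B_mult_def)

lemma B_mult_n: "B_mult n l0 l1 l2 n = Lambda n l0 l1 l2"
  by (simp add: B_mult_def Lambda_def power2_eq_square power3_eq_cube algebra_simps)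

lemma poly_B_op:
  "poly (B_op n l0 l1 l2 P) z = l0 * poly P z + l1 * (of_nat n * z / 2) * poly (pderiv P) z
     + l2 * (of_nat n * z / 2)^2 * poly (pderiv (pderiv P)) z / 2"
  by (simp add: B_op_def algebra_simps power2_eq_square)

text \<open>
  A linear factor \<open>s + t w\<close> is no larger at the origin than at \<open>h\<close> when its zero is closer to the
  origin than to \<open>h\<close>; the case \<open>t = 0\<close> is a factor with its zero at infinity.
\<close>
lemma half_plane_factor:
  fixes s t h :: complex
  assumes "\<And>w. s + t * w = 0 \<Longrightarrow> cmod w \<le> cmod (w - h)" "h \<noteq> 0"
  shows "cmod s \<le> cmod (s + t * h)" "s + t * h \<noteq> 0"
proof -
  show "s + t * h \<noteq> 0"
    using assms(1)[of h] assms(2) by auto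
  show "cmod s \<le> cmod (s + t * h)"
  proof (cases "t = 0")
    case False
    have "cmod (- s / t) \<le> cmod (- s / t - h)"
      by (rule assms(1)) (use False in auto)
    also have "- s / t - h = - ((s + t * h) / t)"
      using False by (simp add: field_simps)
    finally show ?thesis
      using False by (simp add: norm_divide divide_le_cancel)
  qed auto
qed

lemma quadratic_factors:
  fixes a b c :: complex
  obtains s1 t1 s2 t2 where "[:a, b, c:] = [:s1, t1:] * [:s2, t2:]" 
proof (cases "c = 0")
  case True
  then show ?thesis
    using that[of a b 1 0] by simp
next
  case False
  then obtain A where A: "size A = 2" "[:a, b, c:] = smult c (\<Prod>x\<in>#A. [:-x, 1:])"
    using alg_closed_imp_factorization[of "[:a, b, c:]"] by (auto simp: numeral_2_eq_2)
  then obtain x y where "A = {#x, y#}"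
    by (auto simp: numeral_2_eq_2 elim!: size_mset_SucE)
  then show ?thesis
    using that[of "-x*c" c "-y" 1] A(2) by (simp add: algebra_simps)
qed

text \<open>
  The two factors of \<open>U\<close>, either of which may be constant when \<open>U\<close> has degree below two, are
  compared at the origin and at \<open>n / 2\<close>. The two resulting inequalities express the
  half-plane condition in the homogeneous form that Laguerre's theorem needs.
\<close>
lemma B_class_factors:
  assumes "n \<ge> 1" "B_class_params n l0 l1 l2"
  obtains s1 t1 s2 t2 where
    "l0 = s1 * s2" "l1 * of_nat n = s1 * t2 + s2 * t1" "l2 * of_nat (n choose 2) = t1 * t2"
    "cmod s1 \<le> cmod (s1 + t1 * (of_nat n / 2))" "s1 + t1 * (of_nat n / 2) \<noteq> 0"
    "cmod s2 \<le> cmod (s2 + t2 * (of_nat n / 2))" "s2 + t2 * (of_nat n / 2) \<noteq> 0"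
proof -
  obtain s1 t1 s2 t2 where U: "U_poly n l0 l1 l2 = [:s1, t1:] * [:s2, t2:]"
    unfolding U_poly_def using quadratic_factors by metis
  have z: "cmod w \<le> cmod (w - of_nat n / 2)" if "s1 + t1 * w = 0 \<or> s2 + t2 * w = 0" for w
  proof -
    have "poly (U_poly n l0 l1 l2) w = (s1 + t1 * w) * (s2 + t2 * w)"
      unfolding U by (simp add: algebra_simps)
    with that show ?thesis
      using assms(2) unfolding B_class_params_def by auto
  qed
  have h: "(of_nat n / 2 :: complex) \<noteq> 0"
    using assms(1) by simp
  show ?thesis
    using that[of s1 s2 t2 t1] U half_plane_factor[of s1 t1, OF z h] half_plane_factor[of s2 t2, OF z h]
    by (simp add: U_poly_def algebra_simps)
qed

text \<open>
  Both numbers are values of the same polynomial: \<open>\<lambda>\<^sub>0 = U(0)\<close> and \<open>\<Lambda> = U(n / 2)\<close>.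
\<close>
lemma norm_l0_le_Lambda:
  assumes "n \<ge> 1" "B_class_params n l0 l1 l2"
  shows "cmod l0 \<le> cmod (Lambda n l0 l1 l2)" "Lambda n l0 l1 l2 \<noteq> 0"
proof -
  obtain s1 t1 s2 t2 where f:
    "l0 = s1 * s2" "l1 * of_nat n = s1 * t2 + s2 * t1" "l2 * of_nat (n choose 2) = t1 * t2"
    "cmod s1 \<le> cmod (s1 + t1 * (of_nat n / 2))" "s1 + t1 * (of_nat n / 2) \<noteq> 0"
    "cmod s2 \<le> cmod (s2 + t2 * (of_nat n / 2))" "s2 + t2 * (of_nat n / 2) \<noteq> 0"
    using B_class_factors[OF assms] by metis
  have c2: "of_nat (n choose 2) = of_nat n * (of_nat n - 1) / (2 :: complex)"
    by (simp add: binomial_gbinomial gbinomial_prod_rev numeral_2_eq_2)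
  have "Lambda n l0 l1 l2 = l0 + l1 * of_nat n * (of_nat n / 2)
      + l2 * of_nat (n choose 2) * (of_nat n / 2)^2"
    unfolding Lambda_def c2 by (simp add: power2_eq_square power3_eq_cube mult_ac)
  also have "\<dots> = (s1 + t1 * (of_nat n / 2)) * (s2 + t2 * (of_nat n / 2))"
    unfolding f(2,3) by (simp add: f(1) algebra_simps power2_eq_square)
  finally have L: "Lambda n l0 l1 l2 = (s1 + t1 * (of_nat n / 2)) * (s2 + t2 * (of_nat n / 2))" .
  show "Lambda n l0 l1 l2 \<noteq> 0"
    using f L by simp
  show "cmod l0 \<le> cmod (Lambda n l0 l1 l2)"
    unfolding L unfolding f(1) norm_mult using f by (intro mult_mono) auto
qed

text \<open>
  For \<open>n \<ge> 2\<close>, at a fixed point \<open>z\<close> outside the disc, \<open>n (n - 1) B[F](z)\<close> is the value at \<open>z\<close> of two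
  successive polar derivatives of \<open>F\<close>, one for each factor of \<open>U\<close>. Their poles depend on \<open>z\<close>, but
  they lie outside the disc, so Laguerre's theorem applies twice with these poles held fixed. For
  \<open>n = 1\<close> the second derivative of \<open>F\<close> vanishes and a single polar derivative suffices.
\<close>
lemma B_op_disc_polys:
  assumes n: "n \<ge> 1" and U: "B_class_params n l0 l1 l2" and F: "F \<in> disc_polys n"
  shows "B_op n l0 l1 l2 F \<in> disc_polys n"
proof (rule disc_polysI)
  have dF: "degree F = n" "coeff F n \<noteq> 0"
    using disc_polysD[OF F] by auto
  show "degree (B_op n l0 l1 l2 F) \<le> n"
    by (rule degree_le) (auto simp: coeff_B_op dF coeff_eq_0)
  show "coeff (B_op n l0 l1 l2 F) n \<noteq> 0"
    using dF norm_l0_le_Lambda[OF n U] by (simp add: coeff_B_op B_mult_n)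
next
  fix z assume z: "cmod z > 1"
  obtain s1 t1 s2 t2 where f:
    "l0 = s1 * s2" "l1 * of_nat n = s1 * t2 + s2 * t1" "l2 * of_nat (n choose 2) = t1 * t2"
    "cmod s1 \<le> cmod (s1 + t1 * (of_nat n / 2))" "s1 + t1 * (of_nat n / 2) \<noteq> 0"
    "cmod s2 \<le> cmod (s2 + t2 * (of_nat n / 2))" "s2 + t2 * (of_nat n / 2) \<noteq> 0"
    using B_class_factors[OF n U] by metis
  \<comment> \<open>The pole attached to the factor \<open>s + t w\<close> of \<open>U\<close> is \<open>b / s\<close>; it satisfies \<open>b - s z = t n z / 2\<close>.\<close>
  define b where "b s t = z * (s + t * (of_nat n / 2))" for s t
  have b: "cmod s < cmod (b s t)"
    if "cmod s \<le> cmod (s + t * (of_nat n / 2))" "s + t * (of_nat n / 2) \<noteq> 0" for s t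
  proof -
    have "1 * cmod (s + t * (of_nat n / 2)) < cmod z * cmod (s + t * (of_nat n / 2))"
      using that z by (intro mult_strict_right_mono) auto
    then show ?thesis
      using that(1) by (simp only: b_def norm_mult mult_1 le_less_trans)
  qed
  show "poly (B_op n l0 l1 l2 F) z \<noteq> 0"
  proof (cases "n = 1")
    case True
    then have "pderiv (pderiv F) = 0"
      using disc_polysD(1)[OF F] by (simp add: pderiv_eq_0_iff degree_pderiv)
    moreover have "smult (l0 * of_nat (Suc 0)) F + [:b l0 l1, -l0:] * pderiv F \<in> disc_polys 0"
    proof (rule laguerre)
      have "cmod l0 \<le> cmod (l0 + l1 * (of_nat n / 2))"
        using norm_l0_le_Lambda(1)[OF n U] True by (simp add: Lambda_def)
      moreover have "l0 + l1 * (of_nat n / 2) \<noteq> 0"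
        using norm_l0_le_Lambda(2)[OF n U] True by (simp add: Lambda_def)
      ultimately show "cmod l0 < cmod (b l0 l1)"
        by (rule b)
    qed (use F True in auto)
    then have "poly (smult (l0 * of_nat (Suc 0)) F + [:b l0 l1, -l0:] * pderiv F) z \<noteq> 0"
      using disc_polysD(4) z by force
    moreover have "poly (smult (l0 * of_nat (Suc 0)) F + [:b l0 l1, -l0:] * pderiv F) z
        = l0 * poly F z + (b l0 l1 - l0 * z) * poly (pderiv F) z"
      by (simp add: algebra_simps)
    moreover have "b l0 l1 - l0 * z = l1 * (of_nat n * z / 2)"
      by (simp add: b_def algebra_simps)
    ultimately have "l0 * poly F z + l1 * (of_nat n * z / 2) * poly (pderiv F) z \<noteq> 0"
      by metis
    then show ?thesis
      using \<open>pderiv (pderiv F) = 0\<close> by (simp only: poly_B_op poly_0 mult_zero_right div_0 add_0_right not_False_eq_True)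
  next
    case False
    then obtain m where m: "n = Suc (Suc m)"
      using n by (cases n; cases "n - 1") auto
    define G where "G = smult (s1 * of_nat (Suc (Suc m))) F + [:b s1 t1, -s1:] * pderiv F"
    define H where "H = smult (s2 * of_nat (Suc m)) G + [:b s2 t2, -s2:] * pderiv G"
    have "G \<in> disc_polys (Suc m)"
      unfolding G_def by (rule laguerre) (use F f b m in auto)
    then have "H \<in> disc_polys m"
      unfolding H_def by (rule laguerre) (use f b in auto)
    then have Hz: "poly H z \<noteq> 0"
      using disc_polysD(4) z by force
    have c2: "of_nat (n choose 2) = of_nat n * of_nat (Suc m) / (2 :: complex)"
      by (simp add: m binomial_gbinomial gbinomial_prod_rev numeral_2_eq_2 field_simps)
    let ?h = "of_nat n * z / 2"
    have G: "poly G z = s1 * of_nat n * poly F z + t1 * ?h * poly (pderiv F) z"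
      unfolding G_def b_def m by (simp add: algebra_simps)
    have G': "poly (pderiv G) z = s1 * of_nat (Suc m) * poly (pderiv F) z
        + t1 * ?h * poly (pderiv (pderiv F)) z"
    proof -
      have "pderiv ([:x, -s1:] * Q) = [:x, -s1:] * pderiv Q - smult s1 Q" for x Q
        by (subst pderiv_mult) (simp add: pderiv_pCons)
      then have "pderiv G = smult (s1 * of_nat (Suc (Suc m))) (pderiv F)
          + ([:b s1 t1, -s1:] * pderiv (pderiv F) - smult s1 (pderiv F))" (is "_ = ?D")
        unfolding G_def pderiv_add pderiv_smult by metis
      then have "poly (pderiv G) z = poly ?D z"
        by (rule arg_cong)
      also have "\<dots> = s1 * (of_nat (Suc (Suc m)) - 1) * poly (pderiv F) z
          + (b s1 t1 - s1 * z) * poly (pderiv (pderiv F)) z"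
        by (simp add: algebra_simps)
      finally have "poly (pderiv G) z = s1 * (of_nat (Suc (Suc m)) - 1) * poly (pderiv F) z
          + (b s1 t1 - s1 * z) * poly (pderiv (pderiv F)) z" .
      moreover have "b s1 t1 - s1 * z = t1 * ?h"
        by (simp add: b_def algebra_simps)
      ultimately show ?thesis
        by (simp add: algebra_simps)
    qed
    have "poly H z = s2 * of_nat (Suc m) * poly G z + t2 * ?h * poly (pderiv G) z"
      unfolding H_def b_def by (simp add: algebra_simps)
    also have "\<dots> = of_nat n * of_nat (Suc m) * (s1 * s2) * poly F z
      + of_nat (Suc m) * (s1 * t2 + s2 * t1) * ?h * poly (pderiv F) z
      + (t1 * t2) * ?h^2 * poly (pderiv (pderiv F)) z"
      unfolding G G' by (simp add: algebra_simps power2_eq_square)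
    also have "\<dots> = of_nat n * of_nat (Suc m) * poly (B_op n l0 l1 l2 F) z"
      unfolding f(1-3)[symmetric] poly_B_op c2 by (simp add: algebra_simps power2_eq_square)
    finally show ?thesis
      using Hz by auto
  qed
qed

section \<open>The conjugate reversal of a polynomial\<close>

definition star :: "nat \<Rightarrow> complex poly \<Rightarrow> complex poly" where
  "star n P = (\<Sum>k\<le>n. monom (cnj (coeff P (n - k))) k)"

lemma coeff_star: "coeff (star n P) k = (if k \<le> n then cnj (coeff P (n - k)) else 0)"
  by (simp add: star_def coeff_sum sum.delta)

lemma degree_star: "degree (star n P) \<le> n"
  by (rule degree_le) (simp add: coeff_star)

lemma star_star: "degree P \<le> n \<Longrightarrow> star n (star n P) = P"
  by (rule poly_eqI) (auto simp: coeff_star coeff_eq_0)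

lemma poly_eq_sum_le:
  fixes P :: "complex poly"
  assumes "degree P \<le> n"
  shows "poly P z = (\<Sum>k\<le>n. coeff P k * z ^ k)"
  unfolding poly_altdef using assms
  by (intro sum.mono_neutral_left) (auto simp: coeff_eq_0)

text \<open>
  The description of the reversal by values, which explains its modulus on the circle and the
  location of its zeros: roots are mirrored in the circle.
\<close>
lemma poly_star:
  assumes "degree P \<le> n" "z \<noteq> 0"
  shows "poly (star n P) z = z ^ n * cnj (poly P (1 / cnj z))"
proof -
  have "poly (star n P) z = (\<Sum>k\<le>n. cnj (coeff P (n - k)) * z ^ k)"
    by (subst poly_eq_sum_le[OF degree_star]) (simp add: coeff_star)
  also have "\<dots> = (\<Sum>k\<le>n. cnj (coeff P k) * z ^ (n - k))"
    by (rule sum.reindex_bij_witness[of _ "\<lambda>k. n - k" "\<lambda>k. n - k"]) auto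
  also have "\<dots> = (\<Sum>k\<le>n. z ^ n * (cnj (coeff P k) * (1 / z) ^ k))"
    using assms(2) by (intro sum.cong) (auto simp: power_diff power_divide)
  also have "\<dots> = z ^ n * cnj (poly P (1 / cnj z))"
    by (simp add: poly_eq_sum_le[OF assms(1)] sum_distrib_left)
  finally show ?thesis .
qed

lemma poly_star_0: "poly (star n P) 0 = cnj (coeff P n)"
  by (simp add: poly_0_coeff_0 coeff_star)

lemma norm_star_circle:
  assumes "degree P \<le> n" "cmod z = 1"
  shows "cmod (poly (star n P) z) = cmod (poly P z)"
proof -
  have z0: "z \<noteq> 0"
    using assms(2) by auto
  have "z * cnj z = 1"
    using assms(2) complex_norm_square[of z] by simp
  then have "1 / cnj z = z"
    using z0 by (metis complex_cnj_zero_iff nonzero_eq_divide_eq)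
  then show ?thesis
    using assms z0 by (simp add: poly_star norm_mult norm_power)
qed

lemma star_in_disc_polys:
  assumes P: "degree P \<le> n" "\<And>z. cmod z < 1 \<Longrightarrow> poly P z \<noteq> 0"
  shows "star n P \<in> disc_polys n"
proof (rule disc_polysI)
  show "coeff (star n P) n \<noteq> 0"
    using P(2)[of 0] by (simp add: coeff_star poly_0_coeff_0)
  fix z assume z: "cmod z > 1"
  then have "cmod (1 / cnj z) < 1" "z \<noteq> 0"
    by (auto simp: norm_divide divide_less_eq)
  then show "poly (star n P) z \<noteq> 0"
    using P by (simp add: poly_star)
qed (rule degree_star)

text \<open>
  Factor by factor this is \<open>\<bar>1 - cnj u z\<bar> \<le> \<bar>z - u\<bar>\<close>.
\<close>
lemma norm_star_le:
  assumes F: "F \<in> disc_polys n" and z: "cmod z \<ge> 1"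
  shows "cmod (poly (star n F) z) \<le> cmod (poly F z)"
proof -
  obtain A where A: "size A = n" "\<And>u. u \<in># A \<Longrightarrow> cmod u \<le> 1"
    "F = smult (coeff F n) (\<Prod>u\<in>#A. [:-u, 1:])"
    using disc_polys_factor[OF F] by metis
  have z0: "z \<noteq> 0"
    using z by auto
  have "cmod z ^ size A * cmod (poly (\<Prod>u\<in>#A. [:-u, 1:]) (1 / cnj z))
      \<le> cmod (poly (\<Prod>u\<in>#A. [:-u, 1:]) z)"
    using A(2)
  proof (induction A)
    case (add u A)
    define Q where "Q = (\<Prod>u\<in>#A. [:-u, 1:])"
    have Q: "poly (\<Prod>u\<in>#add_mset u A. [:-u, 1:]) x = (x - u) * poly Q x" for x
      by (simp add: Q_def algebra_simps)
    have "cmod z * cmod (1 / cnj z - u) = cmod (1 - cnj u * z)"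
    proof -
      have "cnj (1 - cnj u * z) = cnj z * (1 / cnj z - u)"
        using z0 by (simp add: field_simps)
      then show ?thesis
        by (metis complex_mod_cnj norm_mult)
    qed
    also have "\<dots> \<le> cmod (z - u)"
      using add.prems z by (intro reflected_factor_le) auto
    finally have "(cmod z * cmod (1 / cnj z - u)) * (cmod z ^ size A * cmod (poly Q (1 / cnj z)))
        \<le> cmod (z - u) * cmod (poly Q z)"
      using add unfolding Q_def by (intro mult_mono) auto
    then show ?case
      unfolding Q norm_mult by (simp only: size_add_mset power_Suc mult_ac)
  qed auto
  then have "cmod (coeff F n) * (cmod z ^ n * cmod (poly (\<Prod>u\<in>#A. [:-u, 1:]) (1 / cnj z)))
      \<le> cmod (coeff F n) * cmod (poly (\<Prod>u\<in>#A. [:-u, 1:]) z)"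
    unfolding A(1) by (rule mult_left_mono) simp
  moreover have "poly F x = coeff F n * poly (\<Prod>u\<in>#A. [:-u, 1:]) x" for x
    by (subst A(3)) simp
  moreover have "cmod (poly (star n F) z) = cmod z ^ n * cmod (poly F (1 / cnj z))"
    using poly_star[of F n z] z0 disc_polysD(1)[OF F] by (simp add: norm_mult norm_power)
  ultimately show ?thesis
    by (simp add: norm_mult mult_ac)
qed

lemma norm_coeff_0_le:
  assumes F: "F \<in> disc_polys n"
  shows "cmod (coeff F 0) \<le> cmod (coeff F n)"
proof -
  obtain A where A: "size A = n" "\<And>u. u \<in># A \<Longrightarrow> cmod u \<le> 1"
    "F = smult (coeff F n) (\<Prod>u\<in>#A. [:-u, 1:])"
    using disc_polys_factor[OF F] by metis
  have "cmod (coeff (\<Prod>u\<in>#A. [:-u, 1:]) 0) \<le> 1"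
    using A(2)
  proof (induction A)
    case (add u A)
    then have "cmod u * cmod (coeff (\<Prod>u\<in>#A. [:-u, 1:]) 0) \<le> 1 * 1"
      by (intro mult_mono) auto
    then show ?case
      by (simp add: norm_mult)
  qed auto
  then have "cmod (coeff F n) * cmod (coeff (\<Prod>u\<in>#A. [:-u, 1:]) 0) \<le> cmod (coeff F n)"
    by (intro mult_left_le) auto
  then show ?thesis
    by (subst A(3)) (simp add: norm_mult)
qed

section \<open>Arc length on the unit circle\<close>

text \<open>
  Normalised arc length on the unit circle, as a measure on the whole complex plane, so that
  integrands are plain functions of a complex variable.
\<close>
definition circ :: "complex measure" where
  "circ = distr (uniform_measure lborel {0..2*pi}) borel cis"

lemma cis_borel [measurable]: "cis \<in> borel_measurable borel"
  by (intro borel_measurable_continuous_onI continuous_intros)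

lemma poly_borel [measurable]: "poly (Q :: complex poly) \<in> borel_measurable borel"
  by (intro borel_measurable_continuous_onI continuous_intros)

lemma sets_circ [simp, measurable_cong]: "sets circ = sets borel"
  by (simp add: circ_def)

lemma space_circ [simp]: "space circ = UNIV"
  by (simp add: circ_def)

interpretation circ: prob_space circ
  unfolding circ_def
  by (intro prob_space.prob_space_distr prob_space_uniform_measure) (auto simp: ennreal_eq_0_iff not_le)

lemma prob_circ_UNIV [simp]: "measure circ UNIV = 1"
  using circ.prob_space by simp

interpretation circ2: pair_prob_space circ circ ..

lemma nn_integral_circ:
  assumes [measurable]: "f \<in> borel_measurable borel"
  shows "(\<integral>\<^sup>+z. f z \<partial>circ) = (\<integral>\<^sup>+\<theta>\<in>{0..2*pi}. f (cis \<theta>) \<partial>lborel) / ennreal (2 * pi)"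
  unfolding circ_def by (simp add: nn_integral_distr nn_integral_uniform_measure)

lemma integral_circ:
  fixes f :: "complex \<Rightarrow> real"
  assumes [measurable]: "f \<in> borel_measurable borel"
  shows "(\<integral>z. f z \<partial>circ) = 1 / (2 * pi) * (LBINT \<theta>:{0..2*pi}. f (cis \<theta>))"
proof -
  have "uniform_measure lborel {0..2*pi} = density lborel (\<lambda>x. ennreal (indicator {0..2*pi} x / (2 * pi)))"
    unfolding uniform_measure_def
    by (intro density_cong) (auto simp: divide_ennreal indicator_def ennreal_zero_divide simp flip: ennreal_1)
  then have "(\<integral>z. f z \<partial>circ) = (\<integral>x. (indicator {0..2*pi} x / (2 * pi)) *\<^sub>R f (cis x) \<partial>lborel)"
    unfolding circ_def by (simp add: integral_distr integral_density)
  also have "\<dots> = (\<integral>x. 1 / (2 * pi) * (indicator {0..2*pi} x * f (cis x)) \<partial>lborel)"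
    by (intro Bochner_Integration.integral_cong) auto
  finally show ?thesis
    by (simp add: set_lebesgue_integral_def)
qed

lemma AE_circ_norm: "AE z in circ. cmod z = 1"
  unfolding circ_def by (subst AE_distr_iff) auto

lemma AE_circI: "(\<And>z. cmod z = 1 \<Longrightarrow> P z) \<Longrightarrow> AE z in circ. P z"
  using AE_circ_norm by eventually_elim

lemma AE_circ_neq: "AE z in circ. z \<noteq> a"
proof -
  have "countable {\<theta>. cis \<theta> = a}"
  proof (cases "\<exists>t. cis t = a")
    case True
    then obtain t where t: "cis t = a" by auto
    have "{\<theta>. cis \<theta> = a} \<subseteq> range (\<lambda>k::int. t + 2 * pi * k)"
      using sin_cos_eq_iff[of _ t] by (auto simp: complex_eq_iff t[symmetric])
    then show ?thesis
      by (rule countable_subset) auto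
  qed auto
  then have "{\<theta>. cis \<theta> = a} \<in> null_sets lborel"
    by (rule countable_imp_null_set_lborel)
  then have "AE \<theta> in lborel. cis \<theta> \<noteq> a"
    by (rule AE_I') auto
  then show ?thesis
    unfolding circ_def by (subst AE_distr_iff) (auto intro!: AE_uniform_measureI)
qed

lemma integrable_circ_bounded:
  fixes f :: "complex \<Rightarrow> real"
  assumes "f \<in> borel_measurable borel" "\<And>z. cmod z = 1 \<Longrightarrow> \<bar>f z\<bar> \<le> B"
  shows "integrable circ f"
  using assms by (intro circ.integrable_const_bound[of _ B] AE_circI) auto

lemma integrable_circ_continuous:
  fixes f :: "complex \<Rightarrow> real"
  assumes "f \<in> borel_measurable borel" "continuous_on (sphere 0 1) f"
  shows "integrable circ f"
proof -
  have "bounded (f ` sphere 0 1)"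
    using assms(2) by (intro compact_imp_bounded compact_continuous_image) auto
  then obtain B where "\<forall>z\<in>sphere 0 1. \<bar>f z\<bar> \<le> B"
    by (auto simp: bounded_iff)
  then have "\<And>z. cmod z = 1 \<Longrightarrow> \<bar>f z\<bar> \<le> B"
    by simp
  then show ?thesis
    by (rule integrable_circ_bounded[OF assms(1)])
qed

lemma nn_integral_cis_period:
  fixes h :: "complex \<Rightarrow> ennreal"
  assumes [measurable]: "h \<in> borel_measurable borel"
  shows "(\<integral>\<^sup>+x\<in>{c..<c+2*pi}. h (cis x) \<partial>lborel) = (\<integral>\<^sup>+x\<in>{0..2*pi}. h (cis x) \<partial>lborel)"
proof -
  define I where "I a b = (\<integral>\<^sup>+x\<in>{a..<b}. h (cis x) \<partial>lborel)" for a b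
  have shift: "I (a + 2 * pi * real_of_int k) (b + 2 * pi * real_of_int k) = I a b" for a b k
  proof -
    have "cis (2 * pi * real_of_int k + x) = cis x" for x
      by (simp flip: cis_mult)
    then show ?thesis
      unfolding I_def
      by (subst nn_integral_real_affine[where c = 1 and t = "2 * pi * real_of_int k"])
        (auto intro!: nn_integral_cong simp: indicator_def)
  qed
  have split: "I a b = I a m + I m b" if "a \<le> m" "m \<le> b" for a m b
  proof -
    have "{a..<b} = {a..<m} \<union> {m..<b}"
      using that by auto
    then show ?thesis
      unfolding I_def by (simp add: nn_integral_disjoint_pair)
  qed
  \<comment> \<open>Cut at the multiple of \<open>2 pi\<close> inside the interval and move the right piece one period to the left.\<close>
  define k where "k = \<lfloor>c / (2 * pi)\<rfloor>"
  have k: "2 * pi * k \<le> c" "c \<le> 2 * pi * (k + 1)"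
  proof -
    have "real_of_int k \<le> c / (2 * pi)" "c / (2 * pi) \<le> real_of_int k + 1"
      unfolding k_def by linarith+
    then show "2 * pi * k \<le> c" "c \<le> 2 * pi * (k + 1)"
      by (simp_all add: field_simps)
  qed
  have "I c (c + 2 * pi) = I c (2 * pi * (k + 1)) + I (2 * pi * (k + 1)) (c + 2 * pi)"
    by (rule split) (use k in \<open>auto simp: algebra_simps\<close>)
  also have "I (2 * pi * (k + 1)) (c + 2 * pi) = I (2 * pi * k) c"
    using shift[of "2 * pi * k" 1 c] by (simp add: algebra_simps)
  also have "I c (2 * pi * (k + 1)) + I (2 * pi * k) c = I (2 * pi * k) (2 * pi * (k + 1))"
    using split[OF k] by (simp add: add.commute)
  also have "\<dots> = I 0 (2 * pi)"
    using shift[of 0 k "2 * pi"] by (simp add: algebra_simps)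
  also have "\<dots> = (\<integral>\<^sup>+x\<in>{0..2*pi}. h (cis x) \<partial>lborel)"
    unfolding I_def using AE_lborel_singleton[of "2 * pi"]
    by (intro nn_integral_cong_AE) (auto simp: indicator_def elim!: eventually_mono)
  finally show ?thesis
    by (simp add: I_def)
qed

text \<open>
  Invariance under rotations and under \<open>z \<mapsto> z^n\<close>: the angle \<open>\<theta>\<close> becomes \<open>t + n \<theta>\<close>, which runs
  through \<open>n\<close> full periods.
\<close>
lemma distr_circ_power:
  assumes "cmod c = 1" "n \<ge> 1"
  shows "distr circ borel (\<lambda>z. c * z ^ n) = circ"
proof (rule measure_eqI)
  fix A assume "A \<in> sets (distr circ borel (\<lambda>z. c * z ^ n))"
  then have A [measurable]: "A \<in> sets borel"
    by simp
  define h :: "complex \<Rightarrow> ennreal" where "h = indicator A"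
  have [measurable]: "h \<in> borel_measurable borel"
    unfolding h_def by measurable
  obtain t where t: "c = cis t"
    using assms(1) by (metis rcis_cmod_Arg rcis_def mult_1 of_real_1)
  have many: "(\<integral>\<^sup>+x\<in>{t..<t+2*pi*real m}. h (cis x) \<partial>lborel)
      = of_nat m * (\<integral>\<^sup>+x\<in>{0..2*pi}. h (cis x) \<partial>lborel)" for m
  proof (induction m)
    case (Suc m)
    have "{t..<t+2*pi*real (Suc m)} = {t..<t+2*pi*real m} \<union> {t+2*pi*real m..<(t+2*pi*real m)+2*pi}"
      by (auto simp: algebra_simps) (smt (verit) mult_nonneg_nonneg of_nat_0_le_iff pi_ge_zero)+
    then have "(\<integral>\<^sup>+x\<in>{t..<t+2*pi*real (Suc m)}. h (cis x) \<partial>lborel)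
        = (\<integral>\<^sup>+x\<in>{t..<t+2*pi*real m}. h (cis x) \<partial>lborel)
          + (\<integral>\<^sup>+x\<in>{t+2*pi*real m..<(t+2*pi*real m)+2*pi}. h (cis x) \<partial>lborel)"
      by (simp only:) (rule nn_integral_disjoint_pair; auto)
    then show ?case
      unfolding Suc nn_integral_cis_period[OF \<open>h \<in> borel_measurable borel\<close>]
      by (simp add: algebra_simps)
  qed simp
  have n: "real n > 0"
    using assms by simp
  have "(\<integral>\<^sup>+x\<in>{t..<t+2*pi*real n}. h (cis x) \<partial>lborel)
      = ennreal (real n) * (\<integral>\<^sup>+x. h (cis (t + real n * x)) * indicator {t..<t+2*pi*real n} (t + real n * x) \<partial>lborel)"
    using n by (subst nn_integral_real_affine[where c = "real n" and t = t]) auto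
  also have "(\<integral>\<^sup>+x. h (cis (t + real n * x)) * indicator {t..<t+2*pi*real n} (t + real n * x) \<partial>lborel)
      = (\<integral>\<^sup>+x\<in>{0..2*pi}. h (c * cis x ^ n) \<partial>lborel)"
  proof (intro nn_integral_cong_AE)
    have "c * cis x ^ n = cis (t + real n * x)" for x
      by (simp only: t Complex.DeMoivre cis_mult)
    moreover have "t + real n * x \<in> {t..<t+2*pi*real n} \<longleftrightarrow> x \<in> {0..<2*pi}" for x
      using n by (auto simp: zero_le_mult_iff mult.commute)
    ultimately show "AE x in lborel. h (cis (t + real n * x)) * indicator {t..<t+2*pi*real n} (t + real n * x)
        = h (c * cis x ^ n) * indicator {0..2*pi} x"
      using AE_lborel_singleton[of "2 * pi"] by (auto simp: indicator_def elim!: eventually_mono)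
  qed
  finally have "ennreal (real n) * (\<integral>\<^sup>+x\<in>{0..2*pi}. h (cis x) \<partial>lborel)
      = ennreal (real n) * (\<integral>\<^sup>+x\<in>{0..2*pi}. h (c * cis x ^ n) \<partial>lborel)"
    using many[of n] by (simp add: ennreal_of_nat_eq_real_of_nat)
  then have "(\<integral>\<^sup>+x\<in>{0..2*pi}. h (cis x) \<partial>lborel) = (\<integral>\<^sup>+x\<in>{0..2*pi}. h (c * cis x ^ n) \<partial>lborel)"
    using n by (subst (asm) ennreal_mult_cancel_left) auto
  then have "(\<integral>\<^sup>+z. h z \<partial>circ) = (\<integral>\<^sup>+z. h (c * z ^ n) \<partial>circ)"
    by (simp add: nn_integral_circ)
  also have "\<dots> = (\<integral>\<^sup>+z. h z \<partial>distr circ borel (\<lambda>z. c * z ^ n))"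
    by (simp add: nn_integral_distr)
  finally show "emeasure (distr circ borel (\<lambda>z. c * z ^ n)) A = emeasure circ A"
    by (simp add: h_def)
qed simp

lemma integral_circ_power:
  fixes f :: "complex \<Rightarrow> real"
  assumes "f \<in> borel_measurable borel" "cmod c = 1" "n \<ge> 1"
  shows "(\<integral>z. f (c * z ^ n) \<partial>circ) = (\<integral>z. f z \<partial>circ)"
  using assms by (subst (2) distr_circ_power[OF assms(2,3), symmetric]) (simp add: integral_distr)

section \<open>Jensen's formula\<close>

lemma circ_mean_value:
  assumes "\<And>z. cmod z \<le> 1 \<Longrightarrow> f field_differentiable (at z)"
    and meas: "(\<lambda>z. Re (f z)) \<in> borel_measurable borel"
  shows "(\<integral>z. Re (f z) \<partial>circ) = Re (f 0)"
proof -
  have c: "continuous_on (cball 0 1) f"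
    using assms(1) by (intro continuous_at_imp_continuous_on ballI field_differentiable_imp_continuous_at) auto
  have "f holomorphic_on ball 0 1"
    using assms(1) by (auto simp: holomorphic_on_def intro: field_differentiable_at_within)
  then have "((\<lambda>u. f u / (u - 0)) has_contour_integral (2 * of_real pi * \<i> * f 0)) (circlepath 0 1)"
    by (intro Cauchy_integral_circlepath c) auto
  then have "((\<lambda>t. f (cis t) / cis t * \<i> * cis t) has_integral (2 * of_real pi * \<i> * f 0)) {0..2*pi}"
    unfolding circlepath_def by (subst (asm) has_contour_integral_part_circlepath_iff) auto
  then have "((\<lambda>t. f (cis t) * \<i>) has_integral (2 * of_real pi * \<i> * f 0)) {0..2*pi}"
    by simp
  from has_integral_linear[OF this bounded_linear_Im]
  have "((\<lambda>t. Re (f (cis t))) has_integral (2 * pi * Re (f 0))) {0..2*pi}"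
    by (simp add: o_def)
  then have i: "integral {0..2*pi} (\<lambda>t. Re (f (cis t))) = 2 * pi * Re (f 0)"
    by (rule integral_unique)
  have "continuous_on {0..2*pi} (\<lambda>t. Re (f (cis t)))"
    by (intro continuous_intros continuous_on_compose2[OF c]) auto
  then have "set_integrable lborel {0..2*pi} (\<lambda>t. Re (f (cis t)))"
    by (rule borel_integrable_atLeastAtMost')
  from set_borel_integral_eq_integral(2)[OF this] show ?thesis
    unfolding integral_circ[OF meas] i by simp
qed

text \<open>
  On the circle \<open>\<bar>z - a\<bar> = \<bar>1 - cnj a z\<bar>\<close>, and \<open>ln \<bar>1 - cnj a z\<bar>\<close> is the real part of a function
  holomorphic on the closed disc with value \<open>0\<close> at the centre.
\<close>
lemma jensen_inside:
  assumes "cmod a < 1"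
  shows "integrable circ (\<lambda>z. ln (cmod (z - a)))" "(\<integral>z. ln (cmod (z - a)) \<partial>circ) = 0"
proof -
  show "integrable circ (\<lambda>z. ln (cmod (z - a)))"
    by (rule integrable_circ_continuous) (use assms in \<open>auto intro!: continuous_intros\<close>)
  define f where "f z = Ln (1 - cnj a * z)" for z
  have pos: "Re (1 - cnj a * z) > 0" if "cmod z \<le> 1" for z
  proof -
    have "Re (cnj a * z) \<le> cmod a * cmod z"
      using complex_Re_le_cmod[of "cnj a * z"] by (simp add: norm_mult)
    also have "\<dots> \<le> cmod a"
      using that by (intro mult_left_le) auto
    finally show ?thesis
      using assms by simp
  qed
  have nz: "1 - cnj a * z \<noteq> 0" if "cmod z \<le> 1" for z
    using pos[OF that] by (metis less_irrefl zero_complex.sel(1))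
  have norm: "cmod (z - a) = cmod (1 - cnj a * z)" if "cmod z = 1" for z
  proof -
    have "z - a = z * cnj (1 - cnj a * z)"
      using that complex_norm_square[of z] by (simp add: algebra_simps)
    then show ?thesis
      using that by (metis complex_mod_cnj mult_1 norm_mult)
  qed
  have "(\<integral>z. ln (cmod (z - a)) \<partial>circ) = (\<integral>z. Re (f z) \<partial>circ)"
  proof (rule integral_cong_AE)
    show "AE z in circ. ln (cmod (z - a)) = Re (f z)"
      using norm nz by (intro AE_circI) (simp add: f_def)
  qed (auto simp: f_def)
  also have "\<dots> = Re (f 0)"
  proof (rule circ_mean_value)
    fix z :: complex assume "cmod z \<le> 1"
    then have "1 - cnj a * z \<notin> \<real>\<^sub>\<le>\<^sub>0"
      using pos[of z] by (auto simp: complex_nonpos_Reals_iff)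
    then show "f field_differentiable at z"
      unfolding f_def field_differentiable_def by (auto intro!: derivative_eq_intros exI)
  qed (auto simp: f_def)
  finally show "(\<integral>z. ln (cmod (z - a)) \<partial>circ) = 0"
    by (simp add: f_def)
qed

text \<open>
  The singularity now lies on the circle. It is approached from inside by \<open>r a\<close> with \<open>r < 1\<close>:
  Fatou's lemma gives integrability of the limit, and then the bound
  \<open>\<bar>z - a\<bar> \<le> 2 \<bar>z - r a\<bar>\<close> permits dominated convergence.
\<close>
lemma jensen_boundary:
  assumes a: "cmod a = 1"
  shows "integrable circ (\<lambda>z. ln (cmod (z - a)))" "(\<integral>z. ln (cmod (z - a)) \<partial>circ) = 0"
proof -
  define r where "r k = 1 - 1 / (real k + 2)" for k :: nat
  have r: "0 \<le> r k" "r k < 1" for k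
    unfolding r_def by (auto simp: field_simps)
  have rlim: "r \<longlonglongrightarrow> 1"
    unfolding r_def by real_asymp
  define s where "s k z = ln (cmod (z - of_real (r k) * a))" for k z
  define f where "f z = ln (cmod (z - a))" for z
  have [measurable]: "s k \<in> borel_measurable borel" "f \<in> borel_measurable borel" for k
    unfolding s_def f_def by measurable
  have ra: "cmod (of_real (r k) * a) < 1" for k
    using r[of k] a by (simp add: norm_mult)
  have s_int: "integrable circ (s k)" "(\<integral>z. s k z \<partial>circ) = 0" for k
    using jensen_inside[OF ra[of k]] unfolding s_def by auto
  have up: "s k z \<le> ln 2" and pos: "cmod (z - of_real (r k) * a) > 0"
    and low: "cmod (z - a) \<le> 2 * cmod (z - of_real (r k) * a)" if z: "cmod z = 1" for k z
  proof -
    have gap: "1 - r k \<le> cmod (z - of_real (r k) * a)"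
      using norm_triangle_ineq2[of z "of_real (r k) * a"] z a r[of k] by (simp add: norm_mult)
    then show p: "cmod (z - of_real (r k) * a) > 0"
      using r(2)[of k] by linarith
    have "cmod (z - of_real (r k) * a) \<le> 2"
      using norm_triangle_ineq4[of z "of_real (r k) * a"] z ra[of k] by linarith
    then show "s k z \<le> ln 2"
      unfolding s_def using p by simp
    have "cmod (z - a) \<le> cmod (z - of_real (r k) * a) + cmod (of_real (r k) * a - a)"
      by (rule norm_diff_triangle_ineq[where b = "of_real (r k) * a" and c = "of_real (r k) * a", simplified]
          | metis norm_triangle_ineq diff_add_cancel add_diff_eq)
    also have "of_real (r k) * a - a = - (of_real (1 - r k) * a)"
      by (simp add: algebra_simps)
    also have "cmod (- (of_real (1 - r k) * a)) = 1 - r k"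
      using r[of k] a by (simp only: norm_minus_cancel norm_mult norm_of_real) simp
    finally show "cmod (z - a) \<le> 2 * cmod (z - of_real (r k) * a)"
      using gap by linarith
  qed
  have lim: "(\<lambda>k. s k z) \<longlonglongrightarrow> f z" if "z \<noteq> a" for z
    unfolding s_def f_def using that
    by (intro tendsto_ln tendsto_norm tendsto_diff tendsto_const)
      (auto intro!: tendsto_eq_intros rlim)
  have ae: "AE z in circ. cmod z = 1 \<and> z \<noteq> a"
    using AE_circ_norm AE_circ_neq[of a] by eventually_elim auto
  have "(\<integral>\<^sup>+z. ennreal (ln 2 - f z) \<partial>circ) \<le> (\<integral>\<^sup>+z. liminf (\<lambda>k. ennreal (ln 2 - s k z)) \<partial>circ)"
  proof (rule nn_integral_mono_AE)
    show "AE z in circ. ennreal (ln 2 - f z) \<le> liminf (\<lambda>k. ennreal (ln 2 - s k z))"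
      using ae
    proof eventually_elim
      case (elim z)
      then have "(\<lambda>k. ennreal (ln 2 - s k z)) \<longlonglongrightarrow> ennreal (ln 2 - f z)"
        by (intro tendsto_ennrealI tendsto_diff tendsto_const lim) auto
      then show ?case
        by (simp add: lim_imp_Liminf)
    qed
  qed
  also have "\<dots> \<le> liminf (\<lambda>k. \<integral>\<^sup>+z. ennreal (ln 2 - s k z) \<partial>circ)"
    by (rule nn_integral_liminf) simp
  also have "(\<lambda>k. \<integral>\<^sup>+z. ennreal (ln 2 - s k z) \<partial>circ) = (\<lambda>k. ennreal (ln 2))"
  proof
    fix k
    have "(\<integral>\<^sup>+z. ennreal (ln 2 - s k z) \<partial>circ) = ennreal (\<integral>z. ln 2 - s k z \<partial>circ)"
      using s_int(1)[of k] up by (intro nn_integral_eq_integral AE_circI) auto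
    also have "(\<integral>z. ln 2 - s k z \<partial>circ) = ln 2"
      using s_int[of k] by (simp add: circ.prob_space)
    finally show "(\<integral>\<^sup>+z. ennreal (ln 2 - s k z) \<partial>circ) = ennreal (ln 2)" .
  qed
  finally have fin: "(\<integral>\<^sup>+z. ennreal (ln 2 - f z) \<partial>circ) < \<infinity>"
    by (auto simp: Liminf_const intro: le_less_trans)
  have fle: "f z \<le> ln 2" if "cmod z = 1" "z \<noteq> a" for z
    using that a norm_triangle_ineq4[of z a] by (simp add: f_def)
  have "integrable circ (\<lambda>z. ln 2 - f z)"
  proof (rule integrableI_nonneg)
    show "AE z in circ. 0 \<le> ln 2 - f z"
      using ae by eventually_elim (use fle in auto)
  qed (use fin in auto)
  from Bochner_Integration.integrable_diff[OF circ.integrable_const[of "ln 2"] this]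
  have f_int: "integrable circ f"
    by simp
  then show "integrable circ (\<lambda>z. ln (cmod (z - a)))"
    unfolding f_def .
  have "(\<lambda>k. \<integral>z. s k z \<partial>circ) \<longlonglongrightarrow> (\<integral>z. f z \<partial>circ)"
  proof (rule integral_dominated_convergence[where w = "\<lambda>z. \<bar>f z\<bar> + ln 2"])
    show "AE z in circ. (\<lambda>k. s k z) \<longlonglongrightarrow> f z"
      using ae by eventually_elim (use lim in auto)
    fix k
    show "AE z in circ. norm (s k z) \<le> \<bar>f z\<bar> + ln 2"
      using ae
    proof eventually_elim
      case (elim z)
      then have "f z \<le> ln (2 * cmod (z - of_real (r k) * a))"
        unfolding f_def using low[of z k] pos[of z k] by (subst ln_le_cancel_iff) auto
      also have "\<dots> = ln 2 + s k z"
        using elim pos[of z k] by (simp add: s_def ln_mult)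
      finally show ?case
        using up[of z k] elim by auto
    qed
  qed (use f_int in auto)
  then show "(\<integral>z. ln (cmod (z - a)) \<partial>circ) = 0"
    unfolding s_int(2) f_def using LIMSEQ_unique tendsto_const by metis
qed

text \<open>
  A point \<open>a\<close> outside the disc is exchanged for its mirror image \<open>1 / cnj a\<close>.
\<close>
lemma jensen_linear:
  shows "integrable circ (\<lambda>z. ln (cmod (z - a)))"
    and "(\<integral>z. ln (cmod (z - a)) \<partial>circ) = ln (max 1 (cmod a))"
proof -
  consider "cmod a < 1" | "cmod a = 1" | "cmod a > 1" by linarith
  then have "integrable circ (\<lambda>z. ln (cmod (z - a))) \<and> (\<integral>z. ln (cmod (z - a)) \<partial>circ) = ln (max 1 (cmod a))"
  proof cases
    case 1
    then show ?thesis using jensen_inside[OF 1] by simp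
  next
    case 2
    then show ?thesis using jensen_boundary[OF 2] by simp
  next
    case 3
    define b where "b = inverse (cnj a)"
    have a0: "a \<noteq> 0" using 3 by auto
    have b: "cmod b < 1"
      using 3 by (simp add: b_def norm_inverse inverse_less_1_iff)
    have eq: "ln (cmod (z - a)) = ln (cmod a) + ln (cmod (z - b))" if "cmod z = 1" for z
    proof -
      have "z - a = - (a * z) * cnj (z - b)"
        using that a0 complex_norm_square[of z] by (simp add: b_def field_simps)
      then have "cmod (z - a) = cmod a * cmod (z - b)"
        using that by (metis complex_mod_cnj mult.right_neutral norm_minus_cancel norm_mult)
      moreover have "z \<noteq> b"
        using that b by auto
      ultimately show ?thesis
        using a0 by (simp add: ln_mult)
    qed
    have i: "integrable circ (\<lambda>z. ln (cmod a) + ln (cmod (z - b)))"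
      using jensen_inside(1)[OF b] by simp
    have "integrable circ (\<lambda>z. ln (cmod (z - a)))"
      by (rule integrable_cong_AE_imp[OF i]) (auto intro!: AE_circI simp: eq)
    moreover have "(\<integral>z. ln (cmod (z - a)) \<partial>circ) = (\<integral>z. ln (cmod a) + ln (cmod (z - b)) \<partial>circ)"
      by (rule integral_cong_AE) (auto intro!: AE_circI simp: eq)
    moreover have "\<dots> = ln (cmod a)"
      using jensen_inside[OF b] by (simp add: circ.prob_space)
    ultimately show ?thesis
      using 3 by simp
  qed
  then show "integrable circ (\<lambda>z. ln (cmod (z - a)))"
    and "(\<integral>z. ln (cmod (z - a)) \<partial>circ) = ln (max 1 (cmod a))" by auto
qed

lemma jensen_prod_roots:
  fixes A :: "complex multiset"
  shows "AE z in circ. poly (\<Prod>u\<in>#A. [:-u, 1:]) z \<noteq> 0"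
    and "integrable circ (\<lambda>z. ln (cmod (poly (\<Prod>u\<in>#A. [:-u, 1:]) z)))"
    and "(\<integral>z. ln (cmod (poly (\<Prod>u\<in>#A. [:-u, 1:]) z)) \<partial>circ) = (\<Sum>u\<in>#A. ln (max 1 (cmod u)))"
proof (induction A)
  case (add u A)
  define Q where "Q = (\<Prod>u\<in>#A. [:-u, 1:])"
  have Q: "poly (\<Prod>u\<in>#add_mset u A. [:-u, 1:]) z = (z - u) * poly Q z" for z
    by (simp add: Q_def algebra_simps)
  have ae: "AE z in circ. z \<noteq> u \<and> poly Q z \<noteq> 0"
    using AE_circ_neq[of u] add.IH(1) unfolding Q_def by eventually_elim auto
  have eq: "AE z in circ. ln (cmod ((z - u) * poly Q z)) = ln (cmod (z - u)) + ln (cmod (poly Q z))"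
    using ae by eventually_elim (simp add: norm_mult ln_mult)
  have i: "integrable circ (\<lambda>z. ln (cmod (z - u)) + ln (cmod (poly Q z)))"
    using jensen_linear(1) add.IH(2) unfolding Q_def by (rule Bochner_Integration.integrable_add)
  case 1
  show ?case
    unfolding Q using ae by eventually_elim auto
  case 2
  show ?case
    unfolding Q by (rule integrable_cong_AE_imp[OF i]) (use eq in \<open>auto elim!: eventually_mono\<close>)
  case 3
  have "(\<integral>z. ln (cmod ((z - u) * poly Q z)) \<partial>circ) = (\<integral>z. ln (cmod (z - u)) + ln (cmod (poly Q z)) \<partial>circ)"
    by (rule integral_cong_AE) (use eq in auto)
  also have "\<dots> = ln (max 1 (cmod u)) + (\<Sum>u\<in>#A. ln (max 1 (cmod u)))"
    using jensen_linear add.IH(2,3) unfolding Q_def by (subst Bochner_Integration.integral_add) auto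
  finally show ?case
    unfolding Q by simp
qed auto

lemma jensen_poly:
  fixes A :: "complex multiset"
  assumes Q: "Q = smult c (\<Prod>u\<in>#A. [:-u, 1:])" and c: "c \<noteq> 0"
  shows "integrable circ (\<lambda>z. ln (cmod (poly Q z)))"
    and "(\<integral>z. ln (cmod (poly Q z)) \<partial>circ) = ln (cmod c) + (\<Sum>u\<in>#A. ln (max 1 (cmod u)))"
proof -
  define S where "S = (\<Prod>u\<in>#A. [:-u, 1:])"
  note S = jensen_prod_roots[of A, folded S_def]
  have eq: "AE z in circ. ln (cmod (poly Q z)) = ln (cmod c) + ln (cmod (poly S z))"
    using S(1) by eventually_elim (use c in \<open>simp add: Q S_def[symmetric] norm_mult ln_mult\<close>)
  have i: "integrable circ (\<lambda>z. ln (cmod c) + ln (cmod (poly S z)))"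
    using S(2) by simp
  show "integrable circ (\<lambda>z. ln (cmod (poly Q z)))"
    by (rule integrable_cong_AE_imp[OF i]) (use eq in \<open>auto elim!: eventually_mono\<close>)
  have "(\<integral>z. ln (cmod (poly Q z)) \<partial>circ) = (\<integral>z. ln (cmod c) + ln (cmod (poly S z)) \<partial>circ)"
    by (rule integral_cong_AE) (use eq in auto)
  also have "\<dots> = ln (cmod c) + (\<Sum>u\<in>#A. ln (max 1 (cmod u)))"
    using S by (simp add: circ.prob_space)
  finally show "(\<integral>z. ln (cmod (poly Q z)) \<partial>circ) = ln (cmod c) + (\<Sum>u\<in>#A. ln (max 1 (cmod u)))" .
qed

lemma integrable_ln_poly:
  assumes "Q \<noteq> 0"
  shows "integrable circ (\<lambda>z. ln (cmod (poly Q z)))" "AE z in circ. poly Q z \<noteq> 0"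
proof -
  obtain A where A: "Q = smult (lead_coeff Q) (\<Prod>u\<in>#A. [:-u, 1:])"
    using alg_closed_imp_factorization[OF assms] by metis
  show "integrable circ (\<lambda>z. ln (cmod (poly Q z)))"
    using jensen_poly(1)[OF A] assms by simp
  show "AE z in circ. poly Q z \<noteq> 0"
    using jensen_prod_roots(1)[of A] by eventually_elim (subst A, use assms in simp)
qed

lemma jensen_disc_polys:
  assumes "F \<in> disc_polys n"
  shows "(\<integral>z. ln (cmod (poly F z)) \<partial>circ) = ln (cmod (coeff F n))"
proof -
  obtain A where A: "\<And>u. u \<in># A \<Longrightarrow> cmod u \<le> 1" "F = smult (coeff F n) (\<Prod>u\<in>#A. [:-u, 1:])"
    using disc_polys_factor[OF assms] by metis
  have "(\<Sum>u\<in>#A. ln (max 1 (cmod u))) = (\<Sum>u\<in>#A. 0)"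
    using A(1) by (intro arg_cong[where f = sum_mset] image_mset_cong) (simp add: max_absorb1)
  then show ?thesis
    using jensen_poly(2)[OF A(2) disc_polysD(3)[OF assms]] by simp
qed

section \<open>Powers as mixtures of positive logarithms\<close>

text \<open>
  Jensen's formula read as a formula for the positive part of the logarithm: averaging over the
  phase \<open>w\<close> of the second summand removes the singularity of \<open>ln \<bar>u\<bar>\<close> at \<open>u = 0\<close>.
\<close>
lemma log_plus_as_mean:
  assumes y: "cmod y = 1"
  shows "integrable circ (\<lambda>w. ln (cmod (u + w * y)))"
    and "(\<integral>w. ln (cmod (u + w * y)) \<partial>circ) = ln (max 1 (cmod u))"
proof -
  have y0: "y \<noteq> 0"
    using y by auto
  have "cmod (u + w * y) = cmod (w - (- u / y))" for w
  proof -
    have "u + w * y = (w - (- u / y)) * y"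
      using y0 by (simp add: field_simps)
    then show ?thesis
      using y by (simp only: norm_mult mult_1_right)
  qed
  then show "integrable circ (\<lambda>w. ln (cmod (u + w * y)))"
    and "(\<integral>w. ln (cmod (u + w * y)) \<partial>circ) = ln (max 1 (cmod u))"
    using jensen_linear[of "- u / y"] y by (simp_all add: norm_divide)
qed

lemma poly_bounded_on_circle:
  obtains C where "C > 0" "\<And>z. cmod z = 1 \<Longrightarrow> cmod (poly P z) \<le> C"
proof -
  have "bounded (poly P ` sphere 0 1)"
    by (intro compact_imp_bounded compact_continuous_image) (auto intro!: continuous_intros)
  then obtain C where C: "C > 0" "\<forall>z\<in>sphere 0 1. cmod (poly P z) \<le> C"
    unfolding bounded_pos by auto
  show ?thesis
    by (rule that[of C]) (use C in auto)
qed

text \<open>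
  Fubini's theorem applied to \<open>ln \<bar>P(z) + w z^n\<bar>\<close>; for fixed \<open>z\<close> on the circle the mean over \<open>w\<close>
  is \<open>log_plus_as_mean\<close> with \<open>y = z^n\<close>.
\<close>
lemma mean_ln_max_eq:
  "integrable circ (\<lambda>w. \<integral>z. ln (cmod (poly P z + w * z ^ n)) \<partial>circ)"
  "(\<integral>w. (\<integral>z. ln (cmod (poly P z + w * z ^ n)) \<partial>circ) \<partial>circ) = (\<integral>z. ln (max 1 (cmod (poly P z))) \<partial>circ)"
proof -
  define h where "h z w = ln (cmod (poly P z + w * z ^ n))" for z w
  have [measurable]: "(\<lambda>x. h (fst x) (snd x)) \<in> borel_measurable (borel \<Otimes>\<^sub>M borel)"
    unfolding h_def by measurable
  obtain C0 where C0: "C0 > 0" "\<And>z. cmod z = 1 \<Longrightarrow> cmod (poly P z) \<le> C0"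
    by (rule poly_bounded_on_circle[of P]) blast
  define C where "C = ln (C0 + 1)"
  have C: "C \<ge> 0" "h z w \<le> C" if "cmod z = 1" "cmod w = 1" for z w
  proof -
    show "C \<ge> 0"
      using C0 by (simp add: C_def)
    have "cmod (poly P z + w * z ^ n) \<le> C0 + 1"
      using norm_triangle_ineq[of "poly P z" "w * z ^ n"] C0(2)[of z] that
      by (simp add: norm_mult norm_power)
    then show "h z w \<le> C"
      using \<open>C \<ge> 0\<close> C0 by (cases "poly P z + w * z ^ n = 0") (auto simp: h_def C_def)
  qed
  have inner: "integrable circ (h z)" "(\<integral>w. h z w \<partial>circ) = ln (max 1 (cmod (poly P z)))"
    if "cmod z = 1" for z
    using log_plus_as_mean[of "z ^ n" "poly P z"] that unfolding h_def by (simp_all add: norm_power)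
  have int: "integrable (circ \<Otimes>\<^sub>M circ) (\<lambda>x. h (fst x) (snd x))"
  proof (rule circ2.Fubini_integrable)
    show "integrable circ (\<lambda>z. \<integral>w. norm (h (fst (z, w)) (snd (z, w))) \<partial>circ)"
    proof (rule integrable_circ_bounded)
      fix z :: complex assume z: "cmod z = 1"
      have "(\<integral>w. \<bar>h z w\<bar> \<partial>circ) \<le> (\<integral>w. 2 * C - h z w \<partial>circ)"
      proof (rule integral_mono_AE)
        \<comment> \<open>As \<open>h\<close> is bounded above by \<open>C\<close>, a lower bound on its mean controls the mean of \<open>\<bar>h\<bar>\<close>.\<close>
        show "AE w in circ. \<bar>h z w\<bar> \<le> 2 * C - h z w"
        proof (rule AE_circI)
          fix w :: complex assume "cmod w = 1"
          then show "\<bar>h z w\<bar> \<le> 2 * C - h z w"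
            using C[OF z, of w] by linarith
        qed
      qed (use inner[OF z] in auto)
      also have "\<dots> = 2 * C - ln (max 1 (cmod (poly P z)))"
        using inner[OF z] by simp
      also have "\<dots> \<le> 2 * C"
        by simp
      finally show "\<bar>\<integral>w. norm (h (fst (z, w)) (snd (z, w))) \<partial>circ\<bar> \<le> 2 * C"
        by simp
    next
      show "(\<lambda>z. \<integral>w. norm (h (fst (z, w)) (snd (z, w))) \<partial>circ) \<in> borel_measurable borel"
        by measurable
    qed
    show "AE z in circ. integrable circ (\<lambda>w. h (fst (z, w)) (snd (z, w)))"
      using inner by (auto intro!: AE_circI)
  qed measurable
  show "integrable circ (\<lambda>w. \<integral>z. ln (cmod (poly P z + w * z ^ n)) \<partial>circ)"
    using circ2.integrable_snd[of h] int unfolding h_def by (simp add: case_prod_beta')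
  have "(\<integral>w. (\<integral>z. h z w \<partial>circ) \<partial>circ) = (\<integral>z. (\<integral>w. h z w \<partial>circ) \<partial>circ)"
    by (rule circ2.Fubini_integral) (use int in \<open>simp add: case_prod_beta'\<close>)
  also have "\<dots> = (\<integral>z. ln (max 1 (cmod (poly P z))) \<partial>circ)"
    by (rule integral_cong_AE) (auto intro!: AE_circI simp: inner)
  finally show "(\<integral>w. (\<integral>z. ln (cmod (poly P z + w * z ^ n)) \<partial>circ) \<partial>circ) = (\<integral>z. ln (max 1 (cmod (poly P z))) \<partial>circ)"
    unfolding h_def .
qed

text \<open>
  Up to the factor \<open>1 / p\<^sup>2\<close>, the power \<open>u^p\<close> is a positive mixture of the functions
  \<open>u \<mapsto> ln (max 1 (u s))\<close>. With \<open>s = exp x\<close> and \<open>v = ln u\<close> the integrand is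
  \<open>(v + x) exp (- p x)\<close> on \<open>x \<ge> - v\<close> and zero elsewhere.
\<close>
lemma powr_as_log_plus_integral:
  assumes p: "p > 0" and u: "u \<ge> 0"
  shows "(\<integral>\<^sup>+x. ennreal (ln (max 1 (u * exp x)) * exp (- p * x)) \<partial>lborel) = ennreal (u powr p / p\<^sup>2)"
proof (cases "u = 0")
  case False
  then have u: "u > 0" using u by simp
  define v where "v = ln u"
  define F where "F x = - ((v + x) / p + 1 / p\<^sup>2) * exp (- p * x)" for x
  have "(\<integral>\<^sup>+x. ennreal (ln (max 1 (u * exp x)) * exp (- p * x)) \<partial>lborel)
      = (\<integral>\<^sup>+x. ennreal ((v + x) * exp (- p * x)) * indicator {-v..} x \<partial>lborel)"
  proof (rule nn_integral_cong)
    fix x :: real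
    have e: "u * exp x = exp (v + x)"
      using u by (simp add: v_def exp_add)
    have "ln (max 1 (u * exp x)) = (if x \<ge> - v then v + x else 0)"
      unfolding e by (auto simp: max_def)
    then show "ennreal (ln (max 1 (u * exp x)) * exp (- p * x))
        = ennreal ((v + x) * exp (- p * x)) * indicator {-v..} x"
      by (auto simp: indicator_def)
  qed
  also have "\<dots> = ennreal (0 - F (- v))"
  proof (rule nn_integral_FTC_atLeast)
    show "(F has_real_derivative (v + x) * exp (- p * x)) (at x)" for x
      unfolding F_def using p
      by (auto intro!: derivative_eq_intros simp: field_simps power2_eq_square)
    show "(F \<longlongrightarrow> 0) at_top"
      unfolding F_def using p by real_asymp
  qed auto
  also have "0 - F (- v) = u powr p / p\<^sup>2"
    using u p by (simp add: F_def v_def powr_def)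
  finally show ?thesis .
qed (use p in simp)

lemma powr_mean_mono_from_log_plus:
  fixes f g :: "complex \<Rightarrow> real"
  assumes [measurable]: "f \<in> borel_measurable borel" "g \<in> borel_measurable borel"
    and nonneg: "\<And>z. 0 \<le> f z" "\<And>z. 0 \<le> g z"
    and bound: "\<And>z. cmod z = 1 \<Longrightarrow> f z \<le> C" "\<And>z. cmod z = 1 \<Longrightarrow> g z \<le> C"
    and log: "\<And>s. s > 0 \<Longrightarrow> (\<integral>z. ln (max 1 (f z * s)) \<partial>circ) \<le> (\<integral>z. ln (max 1 (g z * s)) \<partial>circ)"
    and p: "p > 0"
  shows "(\<integral>z. f z powr p \<partial>circ) \<le> (\<integral>z. g z powr p \<partial>circ)"
proof -
  have layer: "(\<integral>\<^sup>+z. ennreal (k z powr p / p\<^sup>2) \<partial>circ)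
      = (\<integral>\<^sup>+x. ennreal (exp (- p * x)) * ennreal (\<integral>z. ln (max 1 (k z * exp x)) \<partial>circ) \<partial>lborel)"
    if [measurable]: "k \<in> borel_measurable borel" and k: "\<And>z. 0 \<le> k z" "\<And>z. cmod z = 1 \<Longrightarrow> k z \<le> C"
    for k :: "complex \<Rightarrow> real"
  proof -
    interpret L: pair_sigma_finite circ lborel ..
    have "(\<integral>\<^sup>+z. ennreal (k z powr p / p\<^sup>2) \<partial>circ)
        = (\<integral>\<^sup>+z. (\<integral>\<^sup>+x. ennreal (ln (max 1 (k z * exp x)) * exp (- p * x)) \<partial>lborel) \<partial>circ)"
      by (rule nn_integral_cong) (rule powr_as_log_plus_integral[OF p k(1), symmetric])
    also have "\<dots> = (\<integral>\<^sup>+x. (\<integral>\<^sup>+z. ennreal (ln (max 1 (k z * exp x)) * exp (- p * x)) \<partial>circ) \<partial>lborel)"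
      by (rule L.Fubini'[symmetric]) measurable
    also have "\<dots> = (\<integral>\<^sup>+x. ennreal (exp (- p * x)) * ennreal (\<integral>z. ln (max 1 (k z * exp x)) \<partial>circ) \<partial>lborel)"
    proof (rule nn_integral_cong)
      fix x :: real
      have "integrable circ (\<lambda>z. ln (max 1 (k z * exp x)))"
      proof (rule integrable_circ_bounded)
        fix z :: complex assume "cmod z = 1"
        then have "max 1 (k z * exp x) \<le> max 1 (C * exp x)"
          using k(2) by (intro max.mono) auto
        then have "ln (max 1 (k z * exp x)) \<le> ln (max 1 (C * exp x))"
          by (rule ln_mono) simp
        then show "\<bar>ln (max 1 (k z * exp x))\<bar> \<le> ln (max 1 (C * exp x))"
          by simp
      qed measurable
      then have "(\<integral>\<^sup>+z. ennreal (ln (max 1 (k z * exp x))) \<partial>circ) = ennreal (\<integral>z. ln (max 1 (k z * exp x)) \<partial>circ)"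
        by (rule nn_integral_eq_integral) auto
      then show "(\<integral>\<^sup>+z. ennreal (ln (max 1 (k z * exp x)) * exp (- p * x)) \<partial>circ)
          = ennreal (exp (- p * x)) * ennreal (\<integral>z. ln (max 1 (k z * exp x)) \<partial>circ)"
        by (subst mult.commute, subst ennreal_mult) (simp_all add: nn_integral_cmult)
    qed
    finally show ?thesis .
  qed
  have i: "integrable circ (\<lambda>z. k z powr p / p\<^sup>2)"
    if [measurable]: "k \<in> borel_measurable borel" and k: "\<And>z. 0 \<le> k z" "\<And>z. cmod z = 1 \<Longrightarrow> k z \<le> C"
    for k :: "complex \<Rightarrow> real"
    using k p by (intro integrable_circ_bounded[of _ "C powr p / p\<^sup>2"])
      (auto intro!: divide_right_mono powr_mono2)
  have "(\<integral>\<^sup>+z. ennreal (f z powr p / p\<^sup>2) \<partial>circ) \<le> (\<integral>\<^sup>+z. ennreal (g z powr p / p\<^sup>2) \<partial>circ)"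
    by (subst (1 2) layer)
      (use nonneg bound in \<open>auto intro!: nn_integral_mono mult_left_mono ennreal_leI log\<close>)
  moreover have "(\<integral>\<^sup>+z. ennreal (f z powr p / p\<^sup>2) \<partial>circ) = ennreal (\<integral>z. f z powr p / p\<^sup>2 \<partial>circ)"
    using nonneg bound i[of f] by (intro nn_integral_eq_integral) auto
  moreover have "(\<integral>\<^sup>+z. ennreal (g z powr p / p\<^sup>2) \<partial>circ) = ennreal (\<integral>z. g z powr p / p\<^sup>2 \<partial>circ)"
    using nonneg bound i[of g] by (intro nn_integral_eq_integral) auto
  ultimately have "(\<integral>z. f z powr p / p\<^sup>2 \<partial>circ) \<le> (\<integral>z. g z powr p / p\<^sup>2 \<partial>circ)"
    by (simp add: integral_nonneg_AE)
  then show ?thesis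
    using p by (simp add: divide_le_cancel)
qed

section \<open>Averages over a rotating summand\<close>

lemma circ_Fubini_bounded:
  fixes h :: "complex \<Rightarrow> complex \<Rightarrow> real"
  assumes [measurable]: "(\<lambda>x. h (fst x) (snd x)) \<in> borel_measurable (borel \<Otimes>\<^sub>M borel)"
    and bound: "\<And>z w. cmod z = 1 \<Longrightarrow> cmod w = 1 \<Longrightarrow> \<bar>h z w\<bar> \<le> B"
  shows "(\<integral>w. (\<integral>z. h z w \<partial>circ) \<partial>circ) = (\<integral>z. (\<integral>w. h z w \<partial>circ) \<partial>circ)"
    and "integrable circ (\<lambda>w. \<integral>z. h z w \<partial>circ)"
    and "integrable circ (\<lambda>z. \<integral>w. h z w \<partial>circ)"
proof -
  have "AE x in circ \<Otimes>\<^sub>M circ. \<bar>h (fst x) (snd x)\<bar> \<le> B"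
  proof (rule circ2.AE_pair_measure)
    show "AE z in circ. AE w in circ. \<bar>h (fst (z, w)) (snd (z, w))\<bar> \<le> B"
      by (intro AE_circI) (simp add: bound)
  qed measurable
  then have int: "integrable (circ \<Otimes>\<^sub>M circ) (case_prod h)"
    by (intro circ2.P.integrable_const_bound[where B = B]) (auto simp: case_prod_beta')
  show "(\<integral>w. (\<integral>z. h z w \<partial>circ) \<partial>circ) = (\<integral>z. (\<integral>w. h z w \<partial>circ) \<partial>circ)"
    by (rule circ2.Fubini_integral[OF int])
  show "integrable circ (\<lambda>w. \<integral>z. h z w \<partial>circ)"
    by (rule circ2.integrable_snd[OF int])
  show "integrable circ (\<lambda>z. \<integral>w. h z w \<partial>circ)"
    by (rule circ2.integrable_fst'[OF int, simplified])
qed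

lemma integrable_circ_norm_powr:
  fixes f :: "complex \<Rightarrow> complex"
  assumes "continuous_on UNIV f" "p > 0"
  shows "integrable circ (\<lambda>z. cmod (f z) powr p)"
proof (rule integrable_circ_continuous)
  have [measurable]: "f \<in> borel_measurable borel"
    using assms(1) by (rule borel_measurable_continuous_onI)
  show "(\<lambda>z. cmod (f z) powr p) \<in> borel_measurable borel"
    by measurable
  show "continuous_on (sphere 0 1) (\<lambda>z. cmod (f z) powr p)"
    using assms by (intro continuous_on_powr' continuous_intros continuous_on_subset[OF assms(1)]) auto
qed

text \<open>
  The phases of \<open>x\<close> and \<open>y\<close> can be absorbed into the rotating variable \<open>w\<close>, so means over \<open>w\<close>
  depend only on the two moduli.
\<close>
lemma norm_add_rotate:
  fixes x y :: complex
  obtains u where "cmod u = 1" "\<And>w. cmod (x + w * y) = cmod (of_real (cmod x) + u * w * of_real (cmod y))"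
proof -
  define sg where "sg x = (if x = 0 then 1 else sgn x)" for x :: complex
  have sg: "cmod (sg x) = 1" "x = sg x * of_real (cmod x)" for x
    by (simp_all add: sg_def norm_sgn) (simp add: sgn_eq)
  have "cmod (x + w * y) = cmod (of_real (cmod x) + (sg y / sg x) * w * of_real (cmod y))" for w
  proof -
    have "sg x \<noteq> 0"
      using sg(1)[of x] by auto
    then have "x + w * y = sg x * (of_real (cmod x) + (sg y / sg x) * w * of_real (cmod y))"
      by (subst (1) sg(2)[of x], subst (1) sg(2)[of y]) (simp add: field_simps)
    then show ?thesis
      using sg(1)[of x] by (simp only: norm_mult mult_1)
  qed
  then show ?thesis
    using that[of "sg y / sg x"] sg(1) by (simp add: norm_divide)
qed

lemma mean_powr_rotate:
  "(\<integral>w. cmod (x + w * y) powr p \<partial>circ) = (\<integral>w. cmod (of_real (cmod x) + w * of_real (cmod y)) powr p \<partial>circ)"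
proof -
  obtain u where u: "cmod u = 1"
    "\<And>w. cmod (x + w * y) = cmod (of_real (cmod x) + u * w * of_real (cmod y))"
    by (rule norm_add_rotate[of x y]) blast
  show ?thesis
    unfolding u(2)
    using integral_circ_power[of "\<lambda>w. cmod (of_real (cmod x) + w * of_real (cmod y)) powr p" u 1] u(1)
    by simp
qed

lemma norm_one_add_le:
  assumes "r \<ge> 1" "cmod w = 1"
  shows "cmod (1 + w) \<le> cmod (1 + w * of_real r)"
proof -
  have "(cmod (1 + w * of_real r))\<^sup>2 - (cmod (1 + w))\<^sup>2 = (r - 1) * ((r + 1) * (cmod w)\<^sup>2 + 2 * Re w)"
    unfolding cmod_power2 by (simp add: algebra_simps power2_eq_square)
  moreover have "\<bar>Re w\<bar> \<le> 1"
    using abs_Re_le_cmod[of w] assms by simp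
  then have "(r - 1) * ((r + 1) * (cmod w)\<^sup>2 + 2 * Re w) \<ge> 0"
    using assms by (intro mult_nonneg_nonneg) auto
  ultimately have "(cmod (1 + w))\<^sup>2 \<le> (cmod (1 + w * of_real r))\<^sup>2"
    by linarith
  then show ?thesis
    by (rule power2_le_imp_le) simp
qed

text \<open>
  After normalising by \<open>\<bar>x\<bar>\<close> the comparison holds for each \<open>w\<close> separately, since
  \<open>\<bar>1 + w\<bar> \<le> \<bar>1 + r w\<bar>\<close> for \<open>r \<ge> 1\<close>.
\<close>
lemma mean_powr_add_ge:
  assumes "cmod x \<le> cmod y" "p > 0"
  shows "cmod x powr p * (\<integral>w. cmod (1 + w) powr p \<partial>circ) \<le> (\<integral>w. cmod (x + w * y) powr p \<partial>circ)"
proof (cases "x = 0")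
  case False
  define r where "r = cmod y / cmod x"
  have r: "r \<ge> 1"
    using assms False by (simp add: r_def)
  have "cmod x powr p * (\<integral>w. cmod (1 + w) powr p \<partial>circ) = (\<integral>w. (cmod x * cmod (1 + w)) powr p \<partial>circ)"
    by (simp add: powr_mult)
  also have "\<dots> \<le> (\<integral>w. cmod (of_real (cmod x) + w * of_real (cmod y)) powr p \<partial>circ)"
  proof (rule integral_mono_AE)
    show "integrable circ (\<lambda>w. (cmod x * cmod (1 + w)) powr p)"
      unfolding norm_mult[symmetric] using assms(2)
      by (rule integrable_circ_norm_powr[rotated]) (auto intro!: continuous_intros)
    show "integrable circ (\<lambda>w. cmod (of_real (cmod x) + w * of_real (cmod y)) powr p)"
      using assms(2) by (rule integrable_circ_norm_powr[rotated]) (auto intro!: continuous_intros)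
    show "AE w in circ. (cmod x * cmod (1 + w)) powr p \<le> cmod (of_real (cmod x) + w * of_real (cmod y)) powr p"
    proof (rule AE_circI)
      fix w :: complex assume w: "cmod w = 1"
      have "of_real (cmod x) + w * of_real (cmod y) = of_real (cmod x) * (1 + w * of_real r)"
        using False by (simp add: r_def field_simps)
      then have "cmod (of_real (cmod x) + w * of_real (cmod y)) = cmod x * cmod (1 + w * of_real r)"
        by (simp only: norm_mult norm_of_real abs_norm_cancel)
      moreover have "cmod x * cmod (1 + w) \<le> cmod x * cmod (1 + w * of_real r)"
        using norm_one_add_le[OF r w] by (intro mult_left_mono) auto
      ultimately show "(cmod x * cmod (1 + w)) powr p \<le> cmod (of_real (cmod x) + w * of_real (cmod y)) powr p"
        using assms by (intro powr_mono2) auto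
    qed
  qed
  finally show ?thesis
    by (simp add: mean_powr_rotate[of x y])
qed (simp add: integral_nonneg_AE)

section \<open>Arestov's inequality for disc-preserving multipliers\<close>

text \<open>
  The coefficient form makes \<open>L\<close> linear and singles out \<open>g n\<close>, the factor at \<open>z^n\<close>, which turns out
  to be the sharp bound of \<open>L\<close> in every norm considered here.
\<close>
locale disc_multiplier =
  fixes n :: nat and g :: "nat \<Rightarrow> complex" and L :: "complex poly \<Rightarrow> complex poly"
  assumes coeff_L: "coeff (L P) k = g k * coeff P k"
    and L_disc_polys: "F \<in> disc_polys n \<Longrightarrow> L F \<in> disc_polys n"
begin

lemma L_add: "L (P + Q) = L P + L Q"
  by (rule poly_eqI) (simp add: coeff_L algebra_simps)

lemma L_smult: "L (smult c P) = smult c (L P)"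
  by (rule poly_eqI) (simp add: coeff_L)

lemma L_monom: "L (monom c n) = monom (g n * c) n"
  by (rule poly_eqI) (simp add: coeff_L)

lemma g_n_nonzero: "g n \<noteq> 0"
  using disc_polysD(3)[OF L_disc_polys[OF monom_disc_polys[of 1 n]]] by (simp add: coeff_L)

text \<open>
  If \<open>\<bar>L G\<bar> > \<bar>L F\<bar>\<close> at \<open>z\<close>, then \<open>w = L G(z) / L F(z)\<close> has modulus greater than \<open>1\<close> and the image
  of \<open>G - w F\<close> vanishes at \<open>z\<close>. But \<open>G - w F\<close> has degree \<open>n\<close> and no zero outside the disc.
\<close>
lemma norm_L_le_outside:
  assumes F: "F \<in> disc_polys n" and G: "degree G \<le> n" "cmod (coeff G n) \<le> cmod (coeff F n)"
    and le: "\<And>z. cmod z > 1 \<Longrightarrow> cmod (poly G z) \<le> cmod (poly F z)" and z: "cmod z > 1"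
  shows "cmod (poly (L G) z) \<le> cmod (poly (L F) z)"
proof (rule ccontr)
  assume "\<not> ?thesis"
  then have gt: "cmod (poly (L F) z) < cmod (poly (L G) z)"
    by simp
  have LF: "poly (L F) z \<noteq> 0"
    using disc_polysD(4)[OF L_disc_polys[OF F]] z by force
  define w where "w = poly (L G) z / poly (L F) z"
  have w: "cmod w > 1"
    using gt LF by (simp add: w_def norm_divide)
  have strict: "x - w * y \<noteq> 0" if "cmod x \<le> cmod y" "y \<noteq> 0" for x y
  proof
    assume "x - w * y = 0"
    then have "cmod x = cmod w * cmod y"
      by (simp add: norm_mult)
    moreover have "1 * cmod y < cmod w * cmod y"
      using w that by (intro mult_strict_right_mono) auto
    ultimately show False
      using that by simp
  qed
  have "G + smult (- w) F \<in> disc_polys n"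
  proof (rule disc_polysI)
    show "degree (G + smult (- w) F) \<le> n"
      using G(1) disc_polysD(1)[OF F] by (intro degree_add_le) (auto intro: order_trans[OF degree_smult_le])
    show "coeff (G + smult (- w) F) n \<noteq> 0"
      using strict[OF G(2) disc_polysD(3)[OF F]] by simp
    fix x assume x: "cmod x > 1"
    then have "poly F x \<noteq> 0"
      using disc_polysD(4)[OF F] by force
    then show "poly (G + smult (- w) F) x \<noteq> 0"
      using strict[OF le[OF x]] by simp
  qed
  from disc_polysD(4)[OF L_disc_polys[OF this]] z have "poly (L (G + smult (- w) F)) z \<noteq> 0"
    by force
  then show False
    using LF by (simp only: L_add L_smult poly_add poly_smult) (simp add: w_def)
qed

lemma norm_L_le:
  assumes F: "F \<in> disc_polys n" and G: "degree G \<le> n" "cmod (coeff G n) \<le> cmod (coeff F n)"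
    and le: "\<And>z. cmod z > 1 \<Longrightarrow> cmod (poly G z) \<le> cmod (poly F z)" and z: "cmod z \<ge> 1"
  shows "cmod (poly (L G) z) \<le> cmod (poly (L F) z)"
proof (rule LIMSEQ_le)
  define x where "x k = z * of_real (1 + 1 / (real k + 1))" for k :: nat
  have "(\<lambda>k. 1 + 1 / (real k + 1)) \<longlonglongrightarrow> 1"
    by real_asymp
  from tendsto_mult[OF tendsto_const tendsto_of_real[OF this], of z]
  have x: "x \<longlonglongrightarrow> z"
    unfolding x_def by simp
  show "(\<lambda>k. cmod (poly (L G) (x k))) \<longlonglongrightarrow> cmod (poly (L G) z)"
    and "(\<lambda>k. cmod (poly (L F) (x k))) \<longlonglongrightarrow> cmod (poly (L F) z)"
    by (intro tendsto_norm tendsto_poly x)+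
  have "cmod (x k) > 1" for k
  proof -
    have "1 * 1 < cmod z * (1 + 1 / (real k + 1))"
      using z by (intro mult_le_less_imp_less) auto
    then show ?thesis
      by (simp only: x_def norm_mult norm_of_real) simp
  qed
  then show "\<exists>N. \<forall>k\<ge>N. cmod (poly (L G) (x k)) \<le> cmod (poly (L F) (x k))"
    using norm_L_le_outside[OF F G le] by blast
qed

text \<open>
  The case of the geometric mean. After reflection of the outer roots both \<open>F\<close> and \<open>L F\<close> have their
  zeros in the disc, and for such polynomials the geometric mean is the modulus of the leading
  coefficient. The hypothesis \<open>L P \<noteq> 0\<close> excludes the convention \<open>ln 0 = 0\<close>.
\<close>
lemma mahler_mean_le:
  assumes P: "degree P \<le> n" and LP: "L P \<noteq> 0"
  shows "(\<integral>z. ln (cmod (poly (L P) z)) \<partial>circ) \<le> ln (cmod (g n)) + (\<integral>z. ln (cmod (poly P z)) \<partial>circ)"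
proof -
  have P0: "P \<noteq> 0"
    using LP by (auto simp: poly_eq_iff coeff_L)
  obtain F where F: "F \<in> disc_polys n" "\<And>z. cmod z = 1 \<Longrightarrow> cmod (poly F z) = cmod (poly P z)"
    "\<And>z. cmod z \<ge> 1 \<Longrightarrow> cmod (poly P z) \<le> cmod (poly F z)" "cmod (coeff P n) \<le> cmod (coeff F n)"
    by (rule reflect_outer_roots[OF P P0]) blast
  have LF: "L F \<in> disc_polys n"
    by (rule L_disc_polys[OF F(1)])
  have "(\<integral>z. ln (cmod (poly (L P) z)) \<partial>circ) \<le> (\<integral>z. ln (cmod (poly (L F) z)) \<partial>circ)"
  proof (rule integral_mono_AE)
    show "integrable circ (\<lambda>z. ln (cmod (poly (L P) z)))" "integrable circ (\<lambda>z. ln (cmod (poly (L F) z)))"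
      using integrable_ln_poly(1) LP disc_polysD(2)[OF LF] by auto
    show "AE z in circ. ln (cmod (poly (L P) z)) \<le> ln (cmod (poly (L F) z))"
      using integrable_ln_poly(2)[OF LP] AE_circ_norm
    proof eventually_elim
      case (elim z)
      then have "cmod (poly (L P) z) \<le> cmod (poly (L F) z)"
        using F by (intro norm_L_le P) auto
      then show ?case
        by (rule ln_mono) (use elim in simp)
    qed
  qed
  also have "\<dots> = ln (cmod (g n)) + ln (cmod (coeff F n))"
    using g_n_nonzero disc_polysD(3)[OF F(1)] jensen_disc_polys[OF LF]
    by (simp add: coeff_L norm_mult ln_mult)
  also have "ln (cmod (coeff F n)) = (\<integral>z. ln (cmod (poly P z)) \<partial>circ)"
    unfolding jensen_disc_polys[OF F(1), symmetric]
    by (rule integral_cong_AE) (auto intro!: AE_circI simp: F(2))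
  finally show ?thesis .
qed

end

locale monic_disc_multiplier = disc_multiplier +
  assumes g_n: "g n = 1"
begin

text \<open>
  Since \<open>g n = 1\<close>, adding \<open>w z^n\<close> commutes with \<open>L\<close>; averaging the inequality for the geometric
  mean over \<open>w\<close> turns both logarithms into their positive parts.
\<close>
lemma log_plus_mean_le:
  assumes P: "degree P \<le> n"
  shows "(\<integral>z. ln (max 1 (cmod (poly (L P) z))) \<partial>circ) \<le> (\<integral>z. ln (max 1 (cmod (poly P z))) \<partial>circ)"
  unfolding mean_ln_max_eq(2)[of _ n, symmetric]
proof (rule integral_mono_AE)
  show "AE w in circ. (\<integral>z. ln (cmod (poly (L P) z + w * z ^ n)) \<partial>circ)
      \<le> (\<integral>z. ln (cmod (poly P z + w * z ^ n)) \<partial>circ)"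
    \<comment> \<open>Only for this one value of \<open>w\<close> can \<open>L (P + w z^n)\<close> be the zero polynomial.\<close>
    using AE_circ_neq[of "- coeff P n"]
  proof eventually_elim
    case (elim w)
    define Q where "Q = P + monom w n"
    have LQ: "L Q = L P + monom w n"
      by (simp add: Q_def L_add L_monom g_n)
    have "coeff (L Q) n = coeff P n + w"
      by (simp add: LQ coeff_L g_n)
    then have "L Q \<noteq> 0"
      using elim by (metis add.commute add_eq_0_iff coeff_0)
    moreover have "degree Q \<le> n"
      unfolding Q_def using P by (intro degree_add_le) (auto intro: degree_monom_le)
    ultimately have "(\<integral>z. ln (cmod (poly (L Q) z)) \<partial>circ) \<le> (\<integral>z. ln (cmod (poly Q z)) \<partial>circ)"
      using mahler_mean_le[of Q] g_n by simp
    then show ?case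
      by (simp add: LQ) (simp add: Q_def poly_monom)
  qed
qed (rule mean_ln_max_eq(1))+

lemma arestov_monic:
  assumes P: "degree P \<le> n" and p: "p > 0"
  shows "(\<integral>z. cmod (poly (L P) z) powr p \<partial>circ) \<le> (\<integral>z. cmod (poly P z) powr p \<partial>circ)"
proof -
  obtain C1 where C1: "\<And>z. cmod z = 1 \<Longrightarrow> cmod (poly (L P) z) \<le> C1"
    by (rule poly_bounded_on_circle[of "L P"]) blast
  obtain C2 where C2: "\<And>z. cmod z = 1 \<Longrightarrow> cmod (poly P z) \<le> C2"
    by (rule poly_bounded_on_circle[of P]) blast
  show ?thesis
  proof (rule powr_mean_mono_from_log_plus[where C = "max C1 C2"])
    fix s :: real assume s: "s > 0"
    have "degree (smult (of_real s) P) \<le> n"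
      using P by (auto intro: order_trans[OF degree_smult_le])
    from log_plus_mean_le[OF this] s
    show "(\<integral>z. ln (max 1 (cmod (poly (L P) z) * s)) \<partial>circ) \<le> (\<integral>z. ln (max 1 (cmod (poly P z) * s)) \<partial>circ)"
      by (simp add: L_smult norm_mult mult.commute)
  qed (use C1 C2 p in \<open>auto simp: le_max_iff_disj\<close>)
qed

end

text \<open>
  Arestov's inequality, reduced to the normalised case by dividing \<open>L\<close> by \<open>g n\<close>.
\<close>
theorem (in disc_multiplier) arestov:
  assumes P: "degree P \<le> n" and p: "p > 0"
  shows "(\<integral>z. cmod (poly (L P) z) powr p \<partial>circ) \<le> cmod (g n) powr p * (\<integral>z. cmod (poly P z) powr p \<partial>circ)"
proof -
  interpret N: monic_disc_multiplier n "\<lambda>k. g k / g n" "\<lambda>P. smult (1 / g n) (L P)"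
  proof
    show "smult (1 / g n) (L F) \<in> disc_polys n" if "F \<in> disc_polys n" for F
      using L_disc_polys[OF that] g_n_nonzero by (simp add: disc_polys_def)
  qed (use g_n_nonzero in \<open>simp_all add: coeff_L\<close>)
  have "cmod (poly (L P) z) = cmod (g n) * cmod (poly (smult (1 / g n) (L P)) z)" for z
    using g_n_nonzero by (simp add: norm_divide norm_mult)
  then have "(\<integral>z. cmod (poly (L P) z) powr p \<partial>circ)
      = (\<integral>z. cmod (g n) powr p * cmod (poly (smult (1 / g n) (L P)) z) powr p \<partial>circ)"
    by (simp only: powr_mult norm_ge_zero)
  also have "\<dots> = cmod (g n) powr p * (\<integral>z. cmod (poly (smult (1 / g n) (L P)) z) powr p \<partial>circ)"
    by simp
  also have "\<dots> \<le> cmod (g n) powr p * (\<integral>z. cmod (poly P z) powr p \<partial>circ)"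
    using N.arestov_monic[OF P p] by (intro mult_left_mono) auto
  finally show ?thesis .
qed

section \<open>The dilated operator and its symmetrisation\<close>

locale dilated_B_op =
  fixes n :: nat and l0 l1 l2 :: complex and R :: real
  assumes n: "n \<ge> 1" and U: "B_class_params n l0 l1 l2" and R: "R > 1"
begin

definition dil_B :: "complex poly \<Rightarrow> complex poly" where
  "dil_B P = B_op n l0 l1 l2 (pcompose P [:0, of_real R:])"

abbreviation (input) lead :: complex where
  "lead \<equiv> of_real R ^ n * Lambda n l0 l1 l2"

lemma coeff_dil_B: "coeff (dil_B P) k = B_mult n l0 l1 l2 k * of_real R ^ k * coeff P k"
  by (simp add: dil_B_def coeff_B_op coeff_pcompose_linear)

lemma coeff_dil_B_n: "coeff (dil_B P) n = lead * coeff P n"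
  by (simp add: coeff_dil_B B_mult_n)

lemma coeff_dil_B_0: "coeff (dil_B P) 0 = l0 * coeff P 0"
  by (simp add: coeff_dil_B B_mult_0)

lemma poly_dil_B: "poly (dil_B P) z = poly (B_op n l0 l1 l2 P) (of_real R * z)"
proof -
  have "dil_B P = pcompose (B_op n l0 l1 l2 P) [:0, of_real R:]"
    by (rule poly_eqI) (simp add: coeff_dil_B coeff_B_op coeff_pcompose_linear)
  then show ?thesis
    by (simp add: poly_pcompose mult.commute)
qed

lemma lead_nonzero: "lead \<noteq> 0" and norm_l0_less_lead: "cmod l0 < cmod lead"
proof -
  have L: "Lambda n l0 l1 l2 \<noteq> 0"
    using norm_l0_le_Lambda[OF n U] by simp
  then show "lead \<noteq> 0"
    using R by simp
  have "cmod l0 \<le> 1 * cmod (Lambda n l0 l1 l2)"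
    using norm_l0_le_Lambda[OF n U] by simp
  also have "\<dots> < R ^ n * cmod (Lambda n l0 l1 l2)"
    using R n L by (intro mult_strict_right_mono one_less_power) auto
  also have "\<dots> = cmod lead"
    using R by (simp add: norm_mult norm_power)
  finally show "cmod l0 < cmod lead" .
qed

text \<open>
  The dilation by \<open>R > 1\<close> moves the zeros strictly inside: they have modulus at most \<open>1 / R\<close>.
\<close>
lemma dil_B_nonzero:
  assumes "F \<in> disc_polys n" "cmod z \<ge> 1"
  shows "poly (dil_B F) z \<noteq> 0"
proof -
  have "1 * 1 < R * cmod z"
    using assms(2) R by (intro mult_less_le_imp_less) auto
  then have "cmod (of_real R * z) > 1"
    using R by (simp add: norm_mult)
  then show ?thesis
    unfolding poly_dil_B using disc_polysD(4)[OF B_op_disc_polys[OF n U assms(1)]] by force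
qed

lemma degree_dil_B: "degree P \<le> n \<Longrightarrow> degree (dil_B P) \<le> n"
  by (rule degree_le) (auto simp: coeff_dil_B coeff_eq_0)

sublocale dil_B: disc_multiplier n "\<lambda>k. B_mult n l0 l1 l2 k * of_real R ^ k" dil_B
proof
  show "dil_B F \<in> disc_polys n" if "F \<in> disc_polys n" for F
    using that disc_polysD[OF that] lead_nonzero
    by (intro disc_polysI degree_dil_B) (auto simp: coeff_dil_B_n dil_B_nonzero)
qed (rule coeff_dil_B)

text \<open>
  The factor of this operator at \<open>z^n\<close> is \<open>R^n \<Lambda> + w cnj \<lambda>\<^sub>0\<close>: it combines the two extreme
  coefficients of \<open>R^n \<Lambda> z + \<lambda>\<^sub>0\<close>. The reversal is applied twice, so the operator is linear and acts
  on each coefficient separately.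
\<close>
definition sym_B :: "complex \<Rightarrow> complex poly \<Rightarrow> complex poly" where
  "sym_B w P = dil_B P + smult w (star n (dil_B (star n P)))"

lemma coeff_sym_B: "coeff (sym_B w P) k = (B_mult n l0 l1 l2 k * of_real R ^ k
    + (if k \<le> n then w * cnj (B_mult n l0 l1 l2 (n - k) * of_real R ^ (n - k)) else 0)) * coeff P k"
  by (simp add: sym_B_def coeff_dil_B coeff_star algebra_simps)

text \<open>
  The quotient of the two polynomials is holomorphic on the closed disc and bounded by \<open>1\<close> on the
  circle by the comparison principle. The maximum principle extends the bound to the interior, and
  it is strict there because the value at the origin has modulus
  \<open>\<bar>\<lambda>\<^sub>0\<bar> / \<bar>R^n \<Lambda>\<bar> < 1\<close>.
\<close>
lemma norm_dil_B_star_less: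
  assumes F: "F \<in> disc_polys n" and z: "cmod z < 1"
  shows "cmod (poly (dil_B (star n F)) z) < cmod (poly (star n (dil_B F)) z)"
proof -
  define H where "H = dil_B (star n F)"
  define K where "K = star n (dil_B F)"
  have dF: "degree F = n" "degree (dil_B F) \<le> n"
    using disc_polysD(1)[OF F] degree_dil_B[of F] by auto
  have K: "poly K x \<noteq> 0" if x: "cmod x \<le> 1" for x
  proof (cases "x = 0")
    case True
    then show ?thesis
      using disc_polysD(3)[OF F] lead_nonzero by (simp add: K_def poly_star_0 coeff_dil_B_n)
  next
    case False
    then have "cmod (1 / cnj x) \<ge> 1"
      using x by (simp add: norm_divide)
    from dil_B_nonzero[OF F this] show ?thesis
      using False dF by (simp add: K_def poly_star)
  qed
  have circle: "cmod (poly H x) \<le> cmod (poly K x)" if x: "cmod x = 1" for x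
  proof -
    have "cmod (poly H x) \<le> cmod (poly (dil_B F) x)"
      unfolding H_def
      by (rule dil_B.norm_L_le[OF F degree_star])
        (use x norm_coeff_0_le[OF F] norm_star_le[OF F] in \<open>auto simp: coeff_star\<close>)
    also have "\<dots> = cmod (poly K x)"
      unfolding K_def using x dF by (simp add: norm_star_circle)
    finally show ?thesis .
  qed
  define f where "f x = poly H x / poly K x" for x
  have hol: "f holomorphic_on ball 0 1"
    unfolding f_def using K by (intro holomorphic_intros) auto
  have le: "cmod (f x) \<le> 1" if "cmod x < 1" for x
  proof (rule maximum_modulus_frontier[of f "ball 0 1"])
    show "f holomorphic_on interior (ball 0 1)"
      using hol by simp
    show "continuous_on (closure (ball 0 1)) f"
      unfolding f_def using K by (intro continuous_intros) auto
    show "cmod (f y) \<le> 1" if "y \<in> frontier (ball 0 1)" for y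
      using that circle[of y] K[of y] by (simp add: f_def norm_divide divide_le_eq)
  qed (use that in auto)
  have "cmod (f 0) < 1"
  proof -
    have "cmod (poly H 0) = cmod l0 * cmod (coeff F n)"
      by (simp add: H_def poly_0_coeff_0 coeff_dil_B_0 coeff_star norm_mult)
    moreover have "cmod (poly K 0) = cmod lead * cmod (coeff F n)"
      by (simp only: K_def poly_star_0 complex_mod_cnj coeff_dil_B_n norm_mult)
    moreover have "cmod l0 * cmod (coeff F n) < cmod lead * cmod (coeff F n)"
      using norm_l0_less_lead disc_polysD(3)[OF F] by (intro mult_strict_right_mono) auto
    ultimately have "cmod (poly H 0) < cmod (poly K 0)"
      by (simp only:)
    then show ?thesis
      using K[of 0] by (simp add: f_def norm_divide divide_less_eq)
  qed
  have "cmod (f z) \<noteq> 1"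
  proof
    assume "cmod (f z) = 1"
    then have "f constant_on ball 0 1"
      using le z by (intro maximum_modulus_principle[OF hol, of "ball 0 1" z]) auto
    then have "f z = f 0"
      using z by (auto simp: constant_on_def)
    then show False
      using \<open>cmod (f z) = 1\<close> \<open>cmod (f 0) < 1\<close> by simp
  qed
  then have "cmod (f z) < 1"
    using le[OF z] by simp
  then show ?thesis
    using K[of z] z by (simp add: f_def norm_divide divide_less_eq H_def K_def)
qed

lemma lead_add_nonzero: "cmod w = 1 \<Longrightarrow> lead + w * cnj l0 \<noteq> 0"
proof
  assume w: "cmod w = 1" and "lead + w * cnj l0 = 0"
  then have "cmod lead = cmod (w * cnj l0)"
    by (metis add_eq_0_iff norm_minus_cancel)
  then show False
    using norm_l0_less_lead w by (simp only: norm_mult complex_mod_cnj)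
qed

text \<open>
  Outside the disc \<open>T F\<close> strictly dominates the reversal of \<open>T F*\<close>, where \<open>T\<close> is the dilated
  operator and \<open>F*\<close> the reversal of \<open>F\<close>; so their sum with a unimodular factor cannot vanish there.
\<close>
lemma sym_B_disc_multiplier:
  assumes w: "cmod w = 1"
  shows "disc_multiplier n (\<lambda>k. B_mult n l0 l1 l2 k * of_real R ^ k
    + (if k \<le> n then w * cnj (B_mult n l0 l1 l2 (n - k) * of_real R ^ (n - k)) else 0)) (sym_B w)"
proof
  fix F assume F: "F \<in> disc_polys n"
  have dF: "degree F = n"
    using disc_polysD(1)[OF F] .
  have deg: "degree (dil_B F) \<le> n" "degree (dil_B (star n F)) \<le> n"
    using dF degree_dil_B degree_star by auto
  show "sym_B w F \<in> disc_polys n"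
  proof (rule disc_polysI)
    show "degree (sym_B w F) \<le> n"
      unfolding sym_B_def using deg
      by (intro degree_add_le) (auto intro: order_trans[OF degree_smult_le] degree_star)
    have "coeff (sym_B w F) n = (lead + w * cnj l0) * coeff F n"
      by (simp add: coeff_sym_B B_mult_n B_mult_0)
    then show "coeff (sym_B w F) n \<noteq> 0"
      using lead_add_nonzero[OF w] disc_polysD(3)[OF F] by simp
    fix z assume z: "cmod z > 1"
    define x where "x = 1 / cnj z"
    have z0: "z \<noteq> 0" and x: "cmod x < 1"
      using z by (auto simp: x_def norm_divide divide_less_eq)
    have "poly (star n (dil_B (star n F))) z = z ^ n * cnj (poly (dil_B (star n F)) x)"
      unfolding x_def by (rule poly_star[OF deg(2) z0])
    moreover have "poly (dil_B F) z = z ^ n * cnj (poly (star n (dil_B F)) x)"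
      using poly_star[OF degree_star z0, of n "dil_B F"] star_star[OF deg(1)] by (simp add: x_def)
    moreover have "cmod z ^ n * cmod (poly (dil_B (star n F)) x) < cmod z ^ n * cmod (poly (star n (dil_B F)) x)"
      using norm_dil_B_star_less[OF F x] z0 by (intro mult_strict_left_mono) auto
    ultimately have lt: "cmod (w * poly (star n (dil_B (star n F))) z) < cmod (poly (dil_B F) z)"
      using w by (simp add: norm_mult norm_power)
    show "poly (sym_B w F) z \<noteq> 0"
    proof
      assume "poly (sym_B w F) z = 0"
      then have "poly (dil_B F) z = - (w * poly (star n (dil_B (star n F))) z)"
        by (simp add: sym_B_def eq_neg_iff_add_eq_0)
      then show False
        using lt by simp
    qed
  qed
qed (rule coeff_sym_B)

text \<open>
  If \<open>P\<close> has no zero in the open disc, then its reversal has all zeros in the closed disc and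
  dominates \<open>P\<close> outside, so the comparison principle applies.
\<close>
lemma norm_dil_B_le_star:
  assumes P: "degree P \<le> n" "\<And>z. cmod z < 1 \<Longrightarrow> poly P z \<noteq> 0" and z: "cmod z \<ge> 1"
  shows "cmod (poly (dil_B P) z) \<le> cmod (poly (dil_B (star n P)) z)"
proof (rule dil_B.norm_L_le)
  have S: "star n P \<in> disc_polys n"
    by (rule star_in_disc_polys[OF P])
  then show "star n P \<in> disc_polys n" .
  show "cmod (coeff P n) \<le> cmod (coeff (star n P) n)"
    using norm_coeff_0_le[OF S] by (simp add: coeff_star)
  show "cmod (poly P z) \<le> cmod (poly (star n P) z)" if "cmod z > 1" for z
    using norm_star_le[OF S, of z] that by (simp add: star_star[OF P(1)])
qed (use P z in auto)

text \<open>
  Arestov's inequality for all symmetrised operators at once, integrated over the unimodular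
  parameter \<open>w\<close>; Fubini's theorem then allows the integral over \<open>w\<close> to be taken first on the left.
\<close>
lemma powr_mean_dil_B_le:
  assumes P: "degree P \<le> n" "\<And>z. cmod z < 1 \<Longrightarrow> poly P z \<noteq> 0" and p: "p > 0"
  shows "(\<integral>z. cmod (poly (dil_B P) z) powr p \<partial>circ) * (\<integral>w. cmod (1 + w) powr p \<partial>circ)
    \<le> (\<integral>w. cmod (l0 + w * lead) powr p \<partial>circ) * (\<integral>z. cmod (poly P z) powr p \<partial>circ)"
proof -
  define F where "F = dil_B P"
  define G where "G = star n (dil_B (star n P))"
  have FG: "cmod (poly F z) \<le> cmod (poly G z)" if "cmod z = 1" for z
    using norm_dil_B_le_star[OF P, of z] that degree_dil_B[OF degree_star]
    by (simp add: F_def G_def norm_star_circle)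
  define h where "h z w = cmod (poly F z + w * poly G z) powr p" for z w
  have meas: "(\<lambda>x. h (fst x) (snd x)) \<in> borel_measurable (borel \<Otimes>\<^sub>M borel)"
    unfolding h_def by measurable
  obtain C1 where C1: "\<And>z. cmod z = 1 \<Longrightarrow> cmod (poly F z) \<le> C1"
    by (rule poly_bounded_on_circle[of F]) blast
  obtain C2 where C2: "\<And>z. cmod z = 1 \<Longrightarrow> cmod (poly G z) \<le> C2"
    by (rule poly_bounded_on_circle[of G]) blast
  have bound: "\<bar>h z w\<bar> \<le> (C1 + C2) powr p" if "cmod z = 1" "cmod w = 1" for z w
    unfolding h_def using that C1[of z] C2[of z] p norm_triangle_ineq[of "poly F z" "w * poly G z"]
    by (auto intro!: powr_mono2 simp: norm_mult)
  note swap = circ_Fubini_bounded[of h, OF meas bound]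
  have F_int: "integrable circ (\<lambda>z. cmod (poly F z) powr p)"
    using p by (intro integrable_circ_norm_powr) (auto intro!: continuous_intros)
  have lin_int: "integrable circ (\<lambda>w. cmod (x + w * y) powr p)" for x y
    using p by (intro integrable_circ_norm_powr) (auto intro!: continuous_intros)
  have "(\<integral>z. cmod (poly F z) powr p \<partial>circ) * (\<integral>w. cmod (1 + w) powr p \<partial>circ)
      = (\<integral>z. cmod (poly F z) powr p * (\<integral>w. cmod (1 + w) powr p \<partial>circ) \<partial>circ)"
    by simp
  also have "\<dots> \<le> (\<integral>z. (\<integral>w. h z w \<partial>circ) \<partial>circ)"
  proof (rule integral_mono_AE)
    show "integrable circ (\<lambda>z. cmod (poly F z) powr p * (\<integral>w. cmod (1 + w) powr p \<partial>circ))"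
      using F_int by (rule integrable_mult_left)
    show "integrable circ (\<lambda>z. \<integral>w. h z w \<partial>circ)"
      by (rule swap(3))
    show "AE z in circ. cmod (poly F z) powr p * (\<integral>w. cmod (1 + w) powr p \<partial>circ) \<le> (\<integral>w. h z w \<partial>circ)"
      unfolding h_def by (intro AE_circI mean_powr_add_ge FG p)
  qed
  also have "\<dots> = (\<integral>w. (\<integral>z. h z w \<partial>circ) \<partial>circ)"
    by (rule swap(1)[symmetric])
  also have "\<dots> \<le> (\<integral>w. cmod (lead + w * cnj l0) powr p * (\<integral>z. cmod (poly P z) powr p \<partial>circ) \<partial>circ)"
  proof (rule integral_mono_AE)
    show "AE w in circ. (\<integral>z. h z w \<partial>circ)
        \<le> cmod (lead + w * cnj l0) powr p * (\<integral>z. cmod (poly P z) powr p \<partial>circ)"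
    proof (rule AE_circI)
      fix w :: complex assume w: "cmod w = 1"
      interpret Mw: disc_multiplier n "\<lambda>k. B_mult n l0 l1 l2 k * of_real R ^ k
        + (if k \<le> n then w * cnj (B_mult n l0 l1 l2 (n - k) * of_real R ^ (n - k)) else 0)" "sym_B w"
        by (rule sym_B_disc_multiplier[OF w])
      show "(\<integral>z. h z w \<partial>circ) \<le> cmod (lead + w * cnj l0) powr p * (\<integral>z. cmod (poly P z) powr p \<partial>circ)"
        using Mw.arestov[OF P(1) p]
        by (simp add: h_def sym_B_def F_def G_def B_mult_n B_mult_0 mult.commute)
    qed
  next
    show "integrable circ (\<lambda>w. cmod (lead + w * cnj l0) powr p * (\<integral>z. cmod (poly P z) powr p \<partial>circ))"
      using lin_int by (rule integrable_mult_left)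
  qed (rule swap(2))
  also have "\<dots> = (\<integral>w. cmod (lead + w * cnj l0) powr p \<partial>circ) * (\<integral>z. cmod (poly P z) powr p \<partial>circ)"
    by (rule integral_mult_left_zero)
  also have "(\<integral>w. cmod (lead + w * cnj l0) powr p \<partial>circ) = (\<integral>w. cmod (l0 + w * cnj lead) powr p \<partial>circ)"
  proof (rule integral_cong_AE)
    show "AE w in circ. cmod (lead + w * cnj l0) powr p = cmod (l0 + w * cnj lead) powr p"
    proof (rule AE_circI)
      fix w :: complex assume w: "cmod w = 1"
      then have "lead + w * cnj l0 = w * cnj (l0 + w * cnj lead)"
        using complex_norm_square[of w] by (simp add: algebra_simps)
      then show "cmod (lead + w * cnj l0) powr p = cmod (l0 + w * cnj lead) powr p"
        using w by (simp only: norm_mult complex_mod_cnj mult_1)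
    qed
  qed auto
  also have "\<dots> = (\<integral>w. cmod (l0 + w * lead) powr p \<partial>circ)"
    using mean_powr_rotate[of l0 "cnj lead" p] mean_powr_rotate[of l0 lead p]
    by (simp only: complex_mod_cnj)
  finally show ?thesis
    by (simp only: F_def)
qed

lemma ln_mean_dil_B_le:
  assumes P: "degree P \<le> n" and TP: "dil_B P \<noteq> 0"
  shows "(\<integral>z. ln (cmod (poly (dil_B P) z)) \<partial>circ) \<le> ln (cmod lead) + (\<integral>z. ln (cmod (poly P z)) \<partial>circ)"
  using dil_B.mahler_mean_le[OF P TP] by (simp add: B_mult_n mult.commute)

end

section \<open>Circle norms and the sharp inequality\<close>

lemma circle_norm_pos: "p \<noteq> 0 \<Longrightarrow> circle_norm p Q = (\<integral>z. cmod (poly Q z) powr p \<partial>circ) powr (1 / p)"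
  by (simp add: circle_norm_def integral_circ)

lemma circle_norm_0: "circle_norm 0 Q = (if Q = 0 then 0 else exp (\<integral>z. ln (cmod (poly Q z)) \<partial>circ))"
  by (simp add: circle_norm_def integral_circ)

text \<open>
  The zeros lie in the closed disc, so by Jensen's formula only the leading coefficient counts.
\<close>
lemma circle_norm_0_binomial:
  assumes "n \<ge> 1" "cmod d \<le> cmod c" "c \<noteq> 0"
  shows "circle_norm 0 (monom c n + [:d:]) = cmod c"
proof -
  have cn: "coeff (monom c n + [:d:]) n = c"
    using assms(1) by (cases n) auto
  have "monom c n + [:d:] \<in> disc_polys n"
  proof (rule disc_polysI)
    show "degree (monom c n + [:d:]) \<le> n"
      by (intro degree_add_le) (auto simp: degree_monom_le)
    fix z assume z: "cmod z > 1"
    have "cmod d < cmod (c * z ^ n)"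
    proof -
      have "cmod c * 1 < cmod c * cmod z ^ n"
        using z assms by (intro mult_strict_left_mono one_less_power) auto
      then show ?thesis
        using assms(2) by (simp add: norm_mult norm_power)
    qed
    then show "poly (monom c n + [:d:]) z \<noteq> 0"
      by (auto simp: poly_monom add_eq_0_iff)
  qed (use cn assms in auto)
  from jensen_disc_polys[OF this] disc_polysD(2)[OF this] show ?thesis
    using cn assms(3) by (simp add: circle_norm_0)
qed

lemma mean_powr_one_add_pos: "(\<integral>w. cmod (1 + w) powr p \<partial>circ) > 0" if "p > 0"
proof -
  have i: "integrable circ (\<lambda>w. cmod (1 + w) powr p)"
    using that by (intro integrable_circ_norm_powr) (auto intro!: continuous_intros)
  have "(\<integral>w. cmod (1 + w) powr p \<partial>circ) \<noteq> 0"
  proof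
    assume "(\<integral>w. cmod (1 + w) powr p \<partial>circ) = 0"
    then have "AE w in circ. cmod (1 + w) powr p = 0"
      using integral_nonneg_eq_0_iff_AE[OF i] by simp
    then have "AE w in circ. False"
      using AE_circ_neq[of "- 1"] by eventually_elim (auto simp: add_eq_0_iff)
    then show False
      by simp
  qed
  then show ?thesis
    by (simp add: less_le integral_nonneg_AE)
qed

theorem corollary2:
  fixes n :: nat and l0 l1 l2 :: complex and p R :: real
  assumes "n \<ge> 1"
    and "B_class_params n l0 l1 l2"
    and "0 \<le> p"
    and "R > 1"
  shows "(\<forall>P :: complex poly.
            degree P \<le> n \<longrightarrow> (\<forall>z. cmod z < 1 \<longrightarrow> poly P z \<noteq> 0) \<longrightarrow>
            circle_norm p (B_op n l0 l1 l2 (pcompose P [:0, of_real R:]))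
              \<le> circle_norm p [:l0, of_real R ^ n * Lambda n l0 l1 l2:]
                  / circle_norm p [:1, 1:] * circle_norm p P)
       \<and> (\<forall>a b :: complex. cmod a = 1 \<longrightarrow> cmod b = 1 \<longrightarrow>
            circle_norm p (B_op n l0 l1 l2 (pcompose (monom a n + [:b:]) [:0, of_real R:]))
              = circle_norm p [:l0, of_real R ^ n * Lambda n l0 l1 l2:]
                  / circle_norm p [:1, 1:] * circle_norm p (monom a n + [:b:]))"
proof -
  interpret dilated_B_op n l0 l1 l2 R
    by standard fact+
  define lam where "lam = of_real R ^ n * Lambda n l0 l1 l2"
  note lam = lead_nonzero norm_l0_less_lead ln_mean_dil_B_le powr_mean_dil_B_le coeff_dil_B_n
  note lam = lam[folded lam_def]
  have dil_B_binomial: "dil_B (monom a n + [:b:]) = monom (lam * a) n + [:l0 * b:]" for a b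
  proof (rule poly_eqI)
    fix k
    show "coeff (dil_B (monom a n + [:b:])) k = coeff (monom (lam * a) n + [:l0 * b:]) k"
      using n by (cases k) (auto simp: coeff_dil_B B_mult_0 B_mult_n lam_def)
  qed
  have pair: "[:c, d:] = monom d 1 + [:c:]" for c d :: complex
    by (simp add: monom_altdef)
  have upper: "circle_norm p (dil_B P) \<le> circle_norm p [:l0, lam:] / circle_norm p [:1, 1:] * circle_norm p P"
    if P: "degree P \<le> n" "\<And>z. cmod z < 1 \<Longrightarrow> poly P z \<noteq> 0" for P
  proof (cases "p = 0")
    case True
    have c: "circle_norm 0 [:l0, lam:] = cmod lam" "circle_norm 0 [:1, 1:] = 1"
      unfolding pair using lam(1,2) circle_norm_0_binomial[of 1] by auto
    have P0: "P \<noteq> 0"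
      using P(2)[of 0] by auto
    show ?thesis
    proof (cases "dil_B P = 0")
      case False
      have "exp (\<integral>z. ln (cmod (poly (dil_B P) z)) \<partial>circ) \<le> exp (ln (cmod lam) + (\<integral>z. ln (cmod (poly P z)) \<partial>circ))"
        using lam(3)[OF P(1) False] by simp
      then show ?thesis
        using False P0 lam(1) unfolding True c by (simp add: circle_norm_0 exp_add)
    qed (use P0 in \<open>simp add: True c circle_norm_0\<close>)
  next
    case False
    then have p: "p > 0"
      using assms by simp
    define A B where "A = (\<integral>w. cmod (1 + w) powr p \<partial>circ)" and "B = (\<integral>w. cmod (l0 + w * lam) powr p \<partial>circ)"
    have A: "A > 0"
      unfolding A_def by (rule mean_powr_one_add_pos[OF p])
    define X Y where "X = (\<integral>z. cmod (poly (dil_B P) z) powr p \<partial>circ)" and "Y = (\<integral>z. cmod (poly P z) powr p \<partial>circ)"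
    have nonneg: "X \<ge> 0" "Y \<ge> 0" "B \<ge> 0"
      by (simp_all add: X_def Y_def B_def integral_nonneg_AE)
    have "X \<le> B / A * Y"
      using lam(4)[OF P p] A by (simp add: A_def B_def X_def Y_def field_simps)
    then have "X powr (1 / p) \<le> (B / A * Y) powr (1 / p)"
      using nonneg p by (intro powr_mono2) auto
    also have "\<dots> = B powr (1 / p) / A powr (1 / p) * Y powr (1 / p)"
      using nonneg A by (simp add: powr_mult powr_divide)
    finally show ?thesis
      using p by (simp add: circle_norm_pos A_def B_def X_def Y_def)
  qed
  have sharp: "circle_norm p (dil_B (monom a n + [:b:]))
      = circle_norm p [:l0, lam:] / circle_norm p [:1, 1:] * circle_norm p (monom a n + [:b:])"
    if ab: "cmod a = 1" "cmod b = 1" for a b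
  proof (cases "p = 0")
    case True
    have "a \<noteq> 0"
      using ab by auto
    then show ?thesis
      unfolding True dil_B_binomial pair
      using lam(1,2) ab n circle_norm_0_binomial[of 1] circle_norm_0_binomial[of n]
      by (simp add: norm_mult)
  next
    case False
    then have p: "p > 0"
      using assms by simp
    have bin: "(\<integral>z. cmod (poly (monom c n + [:d:]) z) powr p \<partial>circ)
        = (\<integral>w. cmod (of_real (cmod d) + w * of_real (cmod c)) powr p \<partial>circ)" for c d
    proof -
      have "(\<integral>z. cmod (d + (1 * z ^ n) * c) powr p \<partial>circ) = (\<integral>w. cmod (d + w * c) powr p \<partial>circ)"
        using n by (intro integral_circ_power[of "\<lambda>w. cmod (d + w * c) powr p" 1 n]) auto
      also have "\<dots> = (\<integral>w. cmod (of_real (cmod d) + w * of_real (cmod c)) powr p \<partial>circ)"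
        by (rule mean_powr_rotate)
      finally show ?thesis
        by (simp add: poly_monom algebra_simps)
    qed
    have l: "(\<integral>z. cmod (poly [:c, d:] z) powr p \<partial>circ)
        = (\<integral>w. cmod (of_real (cmod c) + w * of_real (cmod d)) powr p \<partial>circ)" for c d
      using mean_powr_rotate[of c d p] by simp
    have "circle_norm p [:1, 1:] > 0"
      using mean_powr_one_add_pos[OF p] p by (simp add: circle_norm_pos)
    moreover have "circle_norm p (monom a n + [:b:]) = circle_norm p [:1, 1:]"
      unfolding circle_norm_pos[OF False] bin l ab by simp
    moreover have "circle_norm p (dil_B (monom a n + [:b:])) = circle_norm p [:l0, lam:]"
      unfolding circle_norm_pos[OF False] dil_B_binomial bin l norm_mult ab by simp
    ultimately show ?thesis
      by simp
  qed
  show ?thesis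
    using upper sharp unfolding dil_B_def lam_def by blast
qed

end
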